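(* Let $T>0$, $c\in H^1([0,T];\mathbb{R}^m)$, $r\in\mathbb{R}_+$, and $C(t):=\overline B(c(t),r)$, the closed ball. For each step $h>0$ (with $N=\lfloor T/h\rfloor$) put $C^n:=C(nh)$, $n=0,\dots,N$. Let $\varrho$ and its discrete weights $(R_j)_{j\ge0}$ be as in the context; assume that $(R_j)_{j\ge0}$ is non-increasing with mass one ($h\sum_{j\ge0}R_j=1$), and that the past is constant: $X^{-j}=X^{-1}\in C^0=C(0)$ for all $j\ge2$, where $X^{-1}$ does not depend on $h$. Suppose moreover that $$h\sum_{j\ge1}\left(\frac{R_{j-1}-R_j}{h}\right)^2\frac1{R_j}\le C_R<\infty$$ with $C_R$ independent of $h$. Define, for $n\in\{0,\dots,N\}$, $$X^n:=\operatorname*{argmin}_{W\in C^n}\frac h2\sum_{j\ge1}|W-X^{n-j}|^2R_j .$$ Then there is a constant $C>0$ independent of $h$ such that $$\sup_{n\in\{0,\dots,N\}}|X^n|\le C,\qquad \|\partial_tX_h\|_2^2:=\frac1h\sum_{n=0}^{N-1}|X^{n+1}-X^n|^2\le C,$$ where $X_h$ is the piecewise linear interpolant of $(X^n)$ on $(0,T)$. Consequently, as $h\to0$ along a subsequence, $X_h$ converges in $C^0(0,T;\mathbb{R}^m)$ to some $X\in H^1([0,T];\mathbb{R}^m)$ satisfying $$X(t)=P_{C(t)}(\overline X(t))\quad\text{for a.e. }t\in(0,T),\qquad \overline X(t):=\int_0^\infty\varrho(s)X(t-s)\,ds,$$ where $X(t):=X^{-1}$ for $t<0$.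
   Context: $\varrho:\mathbb{R}_+\to\mathbb{R}_+$ is a Lipschitz kernel with $\int_0^\infty\varrho\,da=1$, $\int_0^\infty(1+a)^2\varrho(a)\,da<\infty$, $\partial_a\varrho\le0$ a.e., and $-\partial_a\varrho/\varrho\le\zeta$ a.e. for some constant $\zeta>0$ (so $\varrho>0$). For $h>0$, $R_j:=\frac1h\int_{jh}^{(j+1)h}\varrho(a)\,da$, $j\ge0$. For simplicity steps $h$ are taken with $T/h\in\mathbb{N}$. $P_K$ denotes Euclidean projection onto the closed convex set $K$. *)

theory Defs
  imports "HOL-Analysis.Analysis"
begin

text \<open>The space \<open>H\<^sup>1([0,T])\<close>, identified with its continuous representatives: the primitives of
  square-integrable functions.\<close>

definition H1_on :: "real \<Rightarrow> (real \<Rightarrow> 'a::euclidean_space) \<Rightarrow> bool" where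
  "H1_on T f \<longleftrightarrow> (\<exists>g. set_borel_measurable lborel {0..T} g
      \<and> set_integrable lborel {0..T} (\<lambda>s. (norm (g s))\<^sup>2)
      \<and> (\<forall>t\<in>{0..T}. f t = f 0 + (LBINT s:{0..t}. g s)))"

definition steps :: "real \<Rightarrow> real set" where
  "steps T = {h. 0 < h \<and> T / h \<in> \<nat>}"

definition weight :: "(real \<Rightarrow> real) \<Rightarrow> real \<Rightarrow> nat \<Rightarrow> real" where
  "weight \<rho> h j = (1 / h) * (LBINT a:{real j * h..real (j + 1) * h}. \<rho> a)"

text \<open>The scheme \<open>X\<^sup>n\<close> with moving constraint \<open>K\<close> and constant past \<open>X\<^sup>-\<^sup>j = x\<close> for \<open>j \<ge> 1\<close>.
  The sum over past instants \<open>j \<ge> 1\<close> is shifted by one, so the summand of index \<open>j\<close> involves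
  \<open>X\<^sup>n\<^sup>-\<^sup>(\<^sup>j\<^sup>+\<^sup>1\<^sup>)\<close>, which is a past datum as soon as \<open>n \<le> j\<close>.\<close>

fun scheme :: "(real \<Rightarrow> real) \<Rightarrow> (real \<Rightarrow> 'a::euclidean_space set) \<Rightarrow> 'a \<Rightarrow> real \<Rightarrow> nat \<Rightarrow> 'a" where
  "scheme \<rho> K x h n =
     arg_min
       (\<lambda>W. h / 2 * (\<Sum>j. (norm (W - (if j < n then scheme \<rho> K x h (n - (j + 1)) else x)))\<^sup>2
                          * weight \<rho> h (j + 1)))
       (\<lambda>W. W \<in> K (real n * h))"

declare scheme.simps [simp del]

text \<open>The continuous function that is affine on each \<open>[n h, (n + 1) h]\<close> and equals \<open>Y n\<close> at
  \<open>n h\<close>.\<close>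

definition interpolant :: "real \<Rightarrow> (nat \<Rightarrow> 'a::euclidean_space) \<Rightarrow> real \<Rightarrow> 'a" where
  "interpolant h Y t =
     (let n = nat \<lfloor>t / h\<rfloor> in Y n + ((t - real n * h) / h) *\<^sub>R (Y (n + 1) - Y n))"

end

theory Submission
  imports Defs "HOL-Probability.Distribution_Functions" "HOL-Complex_Analysis.Great_Picard"
begin

text \<open>Each \<open>X\<^sup>n\<close> is the projection onto the ball \<open>C\<^sup>n\<close> of the barycentre of the past. Since all
  iterates stay in a fixed ball and the weights are non-increasing, the barycentre moves by
  \<open>O(h)\<close> in one step: after an index shift the coefficients \<open>R\<^sub>j - R\<^sub>j\<^sub>+\<^sub>1\<close> telescope. The
  projection onto a translated ball is Lipschitz in the point and in the centre, hence
  \<open>|X\<^sup>n\<^sup>+\<^sup>1 - X\<^sup>n|\<close> is at most the integral of \<open>G = A + 2 |c'|\<close>, an \<open>L\<^sup>2\<close> function independent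
  of \<open>h\<close>, over \<open>[n h, (n + 1) h]\<close>.

  Cauchy-Schwarz turns this into the energy estimate and into equi-Hoelder continuity with
  exponent \<open>1/2\<close>, so Arzela-Ascoli yields a uniform limit \<open>Y\<close> whose increments are again
  dominated by the integral of \<open>G\<close>; by Radon-Nikodym such a function is a primitive of some \<open>g\<close>
  with \<open>|g| \<le> m G\<close>, \<open>m\<close> being the dimension. The limit equation follows by dominated convergence
  in the memory term.\<close>

section \<open>Functions whose increments are dominated by an integral\<close>

text \<open>Instead of an energy bound followed by weak compactness of derivatives, the proof
  carries a pointwise domination: one majorant \<open>G\<close> controls the distance between any
  two nodes, for all steps at once. This inequality contains no derivative, so it survives uniform
  convergence, and H1 regularity of the limit is read off from it. What this requires is the
  converse proved here: dominated increments come from a density.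

  The obstacle in the one-step estimate is the normalisation. The functional omits lag 0, so the
  barycentre is divided by \<open>1 - h R_0\<close> instead of 1. Hence membership in the ball is
  proved without the projection formula, and the increment is estimated separately according to
  whether \<open>h R_0 <= 1/2\<close>.

  Constants: the iterates and the past have norm at most \<open>B\<close>, so differences from the
  past are at most \<open>2 B\<close>; the Lipschitz kernel gives \<open>R_0 <= m\<close>. The 2 in
  front of \<open>|c'|\<close> arises because the centre enters the projection onto a translated
  ball twice.\<close>

text \<open>Extended by constants, \<open>\<Phi> + y\<close> and \<open>\<Phi> - y\<close>, where \<open>\<Phi>\<close> is the primitive of \<open>G\<close>, are
  distribution functions of two finite measures whose sum has density \<open>2 G\<close>; both are therefore
  absolutely continuous.\<close>

lemma density_of_dominated_increments:
  fixes y G :: "real \<Rightarrow> real"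
  assumes T: "0 \<le> T"
    and G [measurable]: "integrable lborel G" and G0: "\<And>s. 0 \<le> G s" and GT: "\<And>s. s \<notin> {0..T} \<Longrightarrow> G s = 0"
    and y: "\<And>s t. 0 \<le> s \<Longrightarrow> s \<le> t \<Longrightarrow> t \<le> T \<Longrightarrow> \<bar>y t - y s\<bar> \<le> (LBINT u:{s..t}. G u)"
  obtains g where "g \<in> borel_measurable borel" "AE s in lborel. \<bar>g s\<bar> \<le> G s"
    "\<And>t. t \<in> {0..T} \<Longrightarrow> y t = y 0 + (LBINT s:{0..t}. g s)"
proof -
  define p where "p u = max 0 (min T u)" for u :: real
  define \<Phi> where "\<Phi> u = integral {0..p u} G" for u
  \<comment> \<open>Subtracting \<open>y 0\<close> makes both functions vanish on the negative axis,
    as the limit 0 at minus infinity demands; domination makes them monotone.\<close>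
  define F where "F u = (y (p u) - y 0) + \<Phi> u" for u
  define D where "D u = \<Phi> u - (y (p u) - y 0)" for u
  have Gm [measurable]: "G \<in> borel_measurable borel" using G by auto
  have Gset: "set_integrable lborel {a..b} G" for a b
    unfolding set_integrable_def using G by (intro integrable_mult_indicator) auto
  have Gio: "G integrable_on {a..b}" for a b
    using set_borel_integral_eq_integral(1)[OF Gset] .
  have LI: "(LBINT u:{a..b}. G u) = integral {a..b} G" for a b
    using set_borel_integral_eq_integral(2)[OF Gset] .
  have p01: "0 \<le> p u" "p u \<le> T" for u using T by (auto simp: p_def)
  have pmono: "u \<le> v \<Longrightarrow> p u \<le> p v" for u v by (auto simp: p_def)
  have pid: "u \<in> {0..T} \<Longrightarrow> p u = u" for u by (auto simp: p_def)
  have p0: "u \<le> 0 \<Longrightarrow> p u = 0" for u using T by (auto simp: p_def)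
  have pT: "T \<le> u \<Longrightarrow> p u = T" for u using T by (auto simp: p_def)
  have \<Phi>diff: "\<Phi> v - \<Phi> u = integral {p u..p v} G" if "u \<le> v" for u v
    using Henstock_Kurzweil_Integration.integral_combine[of 0 "p u" "p v" G] Gio pmono[OF that] p01
    by (simp add: \<Phi>_def)
  have incr: "\<bar>y (p v) - y (p u)\<bar> \<le> \<Phi> v - \<Phi> u" if "u \<le> v" for u v
    using y[of "p u" "p v"] pmono[OF that] p01 by (simp add: \<Phi>diff[OF that] LI)
  have Fmono: "u \<le> v \<Longrightarrow> F u \<le> F v" for u v using incr[of u v] by (simp add: F_def)
  have Dmono: "u \<le> v \<Longrightarrow> D u \<le> D v" for u v using incr[of u v] by (simp add: D_def)
  have FD: "F u + D u = 2 * \<Phi> u" for u by (simp add: F_def D_def)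
  have \<Phi>cont: "continuous_on UNIV \<Phi>"
    unfolding \<Phi>_def
    by (rule continuous_on_compose2[OF indefinite_integral_continuous_1[OF Gio[of 0 T]]])
       (auto simp: p_def T intro!: continuous_intros)
  \<comment> \<open>Increments of \<open>y\<close> are at most those of \<open>\<Phi>\<close>, so
    \<open>F\<close> and \<open>D\<close> vary at most twice as much as \<open>\<Phi>\<close>, which
    is continuous as a primitive.\<close>
  have cont_aux: "continuous_on UNIV H" if "\<And>u v. u \<le> v \<Longrightarrow> \<bar>H v - H u\<bar> \<le> 2 * (\<Phi> v - \<Phi> u)" for H :: "real \<Rightarrow> real"
  proof -
    have "isCont H u" for u
    proof -
      have "((\<lambda>v. 2 * \<bar>\<Phi> v - \<Phi> u\<bar>) \<longlongrightarrow> 2 * \<bar>\<Phi> u - \<Phi> u\<bar>) (at u)"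
        using \<Phi>cont by (intro tendsto_intros) (auto simp: continuous_on_eq_continuous_at isCont_def)
      then have *: "((\<lambda>v. 2 * \<bar>\<Phi> v - \<Phi> u\<bar>) \<longlongrightarrow> 0) (at u)" by simp
      have le: "\<bar>H v - H u\<bar> \<le> 2 * \<bar>\<Phi> v - \<Phi> u\<bar>" for v
        using that[of u v] that[of v u] by (cases "u \<le> v") (auto simp: abs_minus_commute)
      have "((\<lambda>v. H v - H u) \<longlongrightarrow> 0) (at u)"
        by (rule tendsto_rabs_zero_cancel, rule tendsto_sandwich[OF _ _ tendsto_const *]) (auto simp: le)
      then show ?thesis by (simp add: isCont_def LIM_zero_iff)
    qed
    then show ?thesis by (simp add: continuous_on_eq_continuous_at)
  qed
  have Fcont: "continuous_on UNIV F"
  proof (rule cont_aux)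
    fix u v :: real assume "u \<le> v"
    then show "\<bar>F v - F u\<bar> \<le> 2 * (\<Phi> v - \<Phi> u)" using incr[of u v] by (simp add: F_def)
  qed
  have Dcont: "continuous_on UNIV D"
  proof (rule cont_aux)
    fix u v :: real assume "u \<le> v"
    then show "\<bar>D v - D u\<bar> \<le> 2 * (\<Phi> v - \<Phi> u)" using incr[of u v] by (simp add: D_def)
  qed
  have right: "continuous (at_right a) H" if "continuous_on UNIV H" for H :: "real \<Rightarrow> real" and a
    using that by (meson UNIV_I continuous_at_imp_continuous_within continuous_on_eq_continuous_at open_UNIV)
  have bot: "(H \<longlongrightarrow> 0) at_bot" if "\<And>u. u \<le> 0 \<Longrightarrow> H u = 0" for H :: "real \<Rightarrow> real"
    by (rule tendsto_eventually, rule eventually_mono[OF eventually_le_at_bot[of 0]]) (rule that)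
  have top: "(H \<longlongrightarrow> H T) at_top" if "\<And>u. T \<le> u \<Longrightarrow> H u = H T" for H :: "real \<Rightarrow> real"
    by (rule tendsto_eventually, rule eventually_mono[OF eventually_ge_at_top[of T]]) (rule that)
  have \<Phi>0: "\<Phi> u = 0" if "u \<le> 0" for u using that by (simp add: \<Phi>_def p0)
  have Fbot: "(F \<longlongrightarrow> 0) at_bot" by (rule bot) (simp add: F_def \<Phi>0 p0)
  have Dbot: "(D \<longlongrightarrow> 0) at_bot" by (rule bot) (simp add: D_def \<Phi>0 p0)
  have Ftop: "(F \<longlongrightarrow> F T) at_top" by (rule top) (simp add: F_def \<Phi>_def pT)
  have Dtop: "(D \<longlongrightarrow> D T) at_top" by (rule top) (simp add: D_def \<Phi>_def pT)
  have FT: "0 \<le> F T" using Fmono[of 0 T] T by (simp add: F_def \<Phi>0 p0)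
  have DT: "0 \<le> D T" using Dmono[of 0 T] T by (simp add: D_def \<Phi>0 p0)
  define \<mu> where "\<mu> = interval_measure F"
  define \<delta> where "\<delta> = interval_measure D"
  define \<nu> where "\<nu> = density lborel (\<lambda>s. ennreal (2 * G s))"
  \<comment> \<open>The sum of the two measures is assembled by hand so that its distribution
    function \<open>F + D = 2 \<Phi>\<close> can be compared with that of
    \<open>\<nu>\<close>.\<close>
  define M where "M = measure_of UNIV (sets borel) (\<lambda>A. emeasure \<mu> A + emeasure \<delta> A)"
  interpret \<mu>: finite_borel_measure \<mu>
    unfolding \<mu>_def by (rule finite_borel_measure_interval_measure[OF Fmono right[OF Fcont] Fbot Ftop FT])
  interpret \<delta>: finite_borel_measure \<delta>
    unfolding \<delta>_def by (rule finite_borel_measure_interval_measure[OF Dmono right[OF Dcont] Dbot Dtop DT])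
  have sets: "sets \<mu> = sets borel" "sets \<delta> = sets borel" "sets M = sets borel" "sets \<nu> = sets borel"
    by (auto simp: \<mu>_def \<delta>_def M_def \<nu>_def sets.sigma_sets_eq[of borel, simplified])
  have spM: "space M = UNIV" by (simp add: M_def)
  have eM: "emeasure M A = emeasure \<mu> A + emeasure \<delta> A" if "A \<in> sets borel" for A
  proof (rule emeasure_measure_of[OF M_def])
    show "countably_additive (sets M) (\<lambda>A. emeasure \<mu> A + emeasure \<delta> A)"
      unfolding countably_additive_def using sets
      by (auto simp: suminf_add[symmetric] suminf_emeasure)
  qed (use that sets in \<open>auto simp: positive_def\<close>)
  have "finite_measure M"
  proof (rule finite_measureI)
    have "emeasure M UNIV = emeasure \<mu> UNIV + emeasure \<delta> UNIV" by (rule eM) simp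
    then show "emeasure M (space M) \<noteq> \<infinity>"
      using \<mu>.emeasure_finite[of UNIV] \<delta>.emeasure_finite[of UNIV] by (simp add: spM)
  qed
  have e\<nu>: "emeasure \<nu> {..a} = ennreal (2 * \<Phi> a)" for a
  proof -
    have "emeasure \<nu> {..a} = (\<integral>\<^sup>+ s. ennreal (2 * G s) * indicator {..a} s \<partial>lborel)"
      unfolding \<nu>_def by (rule emeasure_density) auto
    also have "\<dots> = (\<integral>\<^sup>+ s. ennreal (2 * (indicator {0..p a} s *\<^sub>R G s)) \<partial>lborel)"
    proof (rule nn_integral_cong_AE)
      \<comment> \<open>For \<open>a < 0\<close> the interval \<open>{0..p a}\<close> is the single
        point 0, which lies outside \<open>{..a}\<close>; this point has to be discarded.\<close>
      have "AE s in lborel. s \<noteq> (0::real)" by (rule AE_lborel_singleton)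
      then show "AE s in lborel. ennreal (2 * G s) * indicator {..a} s = ennreal (2 * (indicator {0..p a} s *\<^sub>R G s))"
      proof eventually_elim
        case (elim s)
        have "ennreal (2 * G s) * indicator {..a} s = ennreal (2 * (indicator {..a} s *\<^sub>R G s))"
          by (auto simp: indicator_def)
        also have "indicator {..a} s *\<^sub>R G s = indicator {0..p a} s *\<^sub>R G s"
          using elim T by (cases "s \<in> {0..T}") (auto simp: GT indicator_def p_def)
        finally show ?case .
      qed
    qed
    also have "\<dots> = ennreal (\<integral>s. 2 * (indicator {0..p a} s *\<^sub>R G s) \<partial>lborel)"
      using Gset[of 0 "p a"] G0 by (intro nn_integral_eq_integral) (auto simp: set_integrable_def)
    also have "(\<integral>s. 2 * (indicator {0..p a} s *\<^sub>R G s) \<partial>lborel) = 2 * \<Phi> a"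
      using LI[of 0 "p a"] by (simp add: \<Phi>_def set_lebesgue_integral_def)
    finally show ?thesis .
  qed
  have "M = \<nu>"
  proof (rule cdf_unique')
    show "finite_borel_measure M"
      using \<open>finite_measure M\<close> sets(3) by (simp add: finite_borel_measure_def finite_borel_measure_axioms_def)
    have "emeasure \<nu> (space \<nu>) = (\<integral>\<^sup>+ s. ennreal (2 * G s) \<partial>lborel)"
      unfolding \<nu>_def by (subst emeasure_density) auto
    also have "\<dots> \<noteq> \<infinity>"
      using G G0 by (subst nn_integral_eq_integral) auto
    finally have "finite_measure \<nu>" by (rule finite_measureI)
    then show "finite_borel_measure \<nu>"
      using sets(4) by (simp add: finite_borel_measure_def finite_borel_measure_axioms_def)
    show "cdf M = cdf \<nu>"
    proof
      fix a
      have "cdf M a = cdf \<mu> a + cdf \<delta> a"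
        unfolding cdf_def measure_def using sets
        by (simp add: eM enn2real_plus \<mu>.emeasure_finite \<delta>.emeasure_finite less_top[symmetric])
      also have "\<dots> = F a + D a"
        unfolding \<mu>_def \<delta>_def
        using cdf_interval_measure[OF Fmono right[OF Fcont] Fbot] cdf_interval_measure[OF Dmono right[OF Dcont] Dbot]
        by simp
      also have "\<dots> = cdf \<nu> a"
      proof -
        have "0 \<le> \<Phi> a" by (simp add: \<Phi>_def integral_nonneg[OF Gio] G0)
        then show ?thesis by (simp add: FD cdf_def measure_def e\<nu>)
      qed
      finally show "cdf M a = cdf \<nu> a" .
    qed
  qed
  then have sum: "emeasure \<mu> A + emeasure \<delta> A = emeasure \<nu> A" if "A \<in> sets borel" for A
    using eM[OF that] by simp
  have \<nu>null: "emeasure \<nu> A = 0" if "A \<in> null_sets lborel" for A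
    using that absolutely_continuousI_density[of "\<lambda>s. ennreal (2 * G s)" lborel]
    by (auto simp: absolutely_continuous_def \<nu>_def)
  have null: "emeasure \<mu> A = 0 \<and> emeasure \<delta> A = 0" if "A \<in> null_sets lborel" for A
  proof -
    have "A \<in> sets borel" using that by auto
    then show ?thesis using sum[of A] \<nu>null[OF that] by simp
  qed
  have ac: "absolutely_continuous lborel \<mu>" "absolutely_continuous lborel \<delta>"
    using null by (auto simp: absolutely_continuous_def sets intro!: null_setsI)
  obtain f where f [measurable]: "f \<in> borel_measurable lborel" and f\<mu>: "density lborel f = \<mu>"
    using sigma_finite_measure.Radon_Nikodym[OF sigma_finite_lborel ac(1)] sets by auto
  obtain f' where f' [measurable]: "f' \<in> borel_measurable lborel" and f\<delta>: "density lborel f' = \<delta>"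
    using sigma_finite_measure.Radon_Nikodym[OF sigma_finite_lborel ac(2)] sets by auto
  \<comment> \<open>Uniqueness of densities then gives \<open>f + f' = 2 G\<close> almost
    everywhere, whence \<open>f <= 2 G\<close> because \<open>f'\<close> is nonnegative.\<close>
  have "density lborel (\<lambda>s. f s + f' s) = \<nu>"
  proof (rule measure_eqI)
    fix A assume "A \<in> sets (density lborel (\<lambda>s. f s + f' s))"
    then have A [measurable]: "A \<in> sets borel" by simp
    have "emeasure (density lborel (\<lambda>s. f s + f' s)) A = (\<integral>\<^sup>+ s. f s * indicator A s + f' s * indicator A s \<partial>lborel)"
      by (subst emeasure_density) (auto simp: distrib_right)
    also have "\<dots> = emeasure \<mu> A + emeasure \<delta> A"
      by (subst nn_integral_add) (auto simp: f\<mu>[symmetric] f\<delta>[symmetric] emeasure_density)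
    finally show "emeasure (density lborel (\<lambda>s. f s + f' s)) A = emeasure \<nu> A" by (simp add: sum)
  qed (simp add: sets)
  then have "AE s in lborel. f s + f' s = ennreal (2 * G s)"
    unfolding \<nu>_def by (intro sigma_finite_measure.density_unique[OF sigma_finite_lborel]) auto
  then have fle: "AE s in lborel. f s \<le> ennreal (2 * G s)"
    by eventually_elim (metis le_iff_add)
  \<comment> \<open>Since \<open>F\<close> is \<open>y - y 0\<close> plus the primitive of
    \<open>G\<close>, the density of \<open>y\<close> is that of \<open>F\<close> minus
    \<open>G\<close>; and \<open>0 <= f <= 2 G\<close> is the same as
    \<open>|g| <= G\<close>.\<close>
  define g where "g s = enn2real (f s) - G s" for s
  have [measurable]: "f \<in> borel_measurable borel" using f by simp
  have ff: "AE s in lborel. enn2real (f s) \<le> 2 * G s \<and> ennreal (enn2real (f s)) = f s"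
    using fle
  proof eventually_elim
    case (elim s)
    then have "f s < top" by (metis ennreal_less_top le_less_trans)
    moreover have "enn2real (f s) \<le> 2 * G s"
      using elim G0[of s] by (metis enn2real_leI mult_nonneg_nonneg zero_le_numeral)
    ultimately show ?case by simp
  qed
  show ?thesis
  proof
    show "g \<in> borel_measurable borel" unfolding g_def by measurable
    show "AE s in lborel. \<bar>g s\<bar> \<le> G s"
      using ff by eventually_elim (auto simp: g_def abs_le_iff)
    fix t assume t: "t \<in> {0..T}"
    have "emeasure \<mu> {0..t} = ennreal (F t - F 0)"
      unfolding \<mu>_def using t by (intro emeasure_interval_measure_Icc Fmono Fcont) auto
    also have "emeasure \<mu> {0..t} = (\<integral>\<^sup>+ s. f s * indicator {0..t} s \<partial>lborel)"
      by (simp add: f\<mu>[symmetric] emeasure_density)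
    also have "\<dots> = (\<integral>\<^sup>+ s. ennreal (indicator {0..t} s *\<^sub>R enn2real (f s)) \<partial>lborel)"
      by (rule nn_integral_cong_AE, use ff in eventually_elim) (auto simp: indicator_def)
    finally have nn: "(\<integral>\<^sup>+ s. ennreal (indicator {0..t} s *\<^sub>R enn2real (f s)) \<partial>lborel) = ennreal (F t - F 0)" .
    have F0: "0 \<le> F t - F 0" using Fmono[of 0 t] t by auto
    have I: "(LBINT s:{0..t}. enn2real (f s)) = F t - F 0"
      unfolding set_lebesgue_integral_def
      by (rule integral_eq_nn_integral[THEN trans]) (use nn F0 in auto)
    have J: "set_integrable lborel {0..t} (\<lambda>s. enn2real (f s))"
      unfolding set_integrable_def using nn F0 by (intro integrableI_nonneg) auto
    have "(LBINT s:{0..t}. g s) = (F t - F 0) - \<Phi> t"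
      unfolding g_def using t by (simp add: set_integral_diff[OF J Gset] I LI \<Phi>_def pid)
    then show "y t = y 0 + (LBINT s:{0..t}. g s)"
      using t T by (simp add: F_def pid p0 \<Phi>0)
  qed
qed

section \<open>Square-integrable majorants and their relation to \<open>H1_on\<close>\<close>

lemma integrable_indicator_Icc: "integrable lborel (indicator {a..b::real} :: real \<Rightarrow> real)"
  by (rule integrable_real_indicator) (simp_all add: emeasure_lborel_Icc_eq)

text \<open>The admissible majorants of speeds. Extension by zero makes every interval integral
  meaningful without side conditions on the endpoints.\<close>

definition L2_density :: "real \<Rightarrow> (real \<Rightarrow> real) \<Rightarrow> bool" where
  "L2_density T G \<longleftrightarrow> G \<in> borel_measurable borel \<and> (\<forall>s. 0 \<le> G s) \<and> (\<forall>s. s \<notin> {0..T} \<longrightarrow> G s = 0)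
     \<and> integrable lborel (\<lambda>s. (G s)\<^sup>2)"

text \<open>On the bounded interval \<open>2 G <= 1 + G^2\<close>, and \<open>G\<close> vanishes
  elsewhere.\<close>

lemma L2_density_integrable:
  assumes "L2_density T G"
  shows "integrable lborel G"
proof (rule Bochner_Integration.integrable_bound)
  show "integrable lborel (\<lambda>s. indicator {0..T} s + (G s)\<^sup>2)"
    using assms integrable_indicator_Icc by (simp add: L2_density_def)
  show "G \<in> borel_measurable lborel" using assms by (simp add: L2_density_def)
  have "\<bar>G s\<bar> \<le> \<bar>indicator {0..T} s + (G s)\<^sup>2\<bar>" for s
  proof (cases "s \<in> {0..T}")
    case True
    have "2 * G s \<le> 1 + (G s)\<^sup>2" using sum_squares_bound[of 1 "G s"] by simp
    moreover have "0 \<le> G s" using assms by (simp add: L2_density_def)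
    ultimately show ?thesis using True by simp
  qed (use assms in \<open>simp add: L2_density_def\<close>)
  then show "AE s in lborel. norm (G s) \<le> norm (indicator {0..T} s + (G s)\<^sup>2)" by simp
qed

lemma L2_density_set_integrable:
  assumes "L2_density T G"
  shows "set_integrable lborel {a..b} G" and "set_integrable lborel {a..b} (\<lambda>s. (G s)\<^sup>2)"
  using L2_density_integrable[OF assms] assms unfolding set_integrable_def L2_density_def
  by (auto intro!: integrable_mult_indicator simp del: real_scaleR_def)

lemma set_integral_combine:
  fixes f :: "real \<Rightarrow> 'a::euclidean_space"
  assumes "set_integrable lborel {a..c} f" "a \<le> b" "b \<le> c"
  shows "(LBINT s:{a..c}. f s) = (LBINT s:{a..b}. f s) + (LBINT s:{b..c}. f s)"
proof -
  have "set_integrable lborel {a..b} f" "set_integrable lborel {b..c} f"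
    by (rule set_integrable_subset[OF assms(1)]; use assms in auto)+
  then show ?thesis
    using Henstock_Kurzweil_Integration.integral_combine[OF assms(2,3) set_borel_integral_eq_integral(1)[OF assms(1)]]
    by (simp add: set_borel_integral_eq_integral(2) assms(1))
qed

text \<open>Serves to add the constant speed caused by the memory to twice the speed of the
  centre.\<close>

lemma L2_density_affine:
  assumes G: "L2_density T G" and A: "0 \<le> A" "0 \<le> B"
  shows "L2_density T (\<lambda>s. A * indicator {0..T} s + B * G s)"
  unfolding L2_density_def
proof (intro conjI allI impI)
  have [measurable]: "G \<in> borel_measurable borel" using G by (simp add: L2_density_def)
  show "(\<lambda>s. A * indicator {0..T} s + B * G s) \<in> borel_measurable borel" by measurable
  have eq: "(A * indicator {0..T} s + B * G s)\<^sup>2 = A\<^sup>2 * indicator {0..T} s + 2 * A * B * G s + B\<^sup>2 * (G s)\<^sup>2" for s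
    using G by (cases "s \<in> {0..T}") (auto simp: L2_density_def power2_sum power_mult_distrib)
  have "integrable lborel (\<lambda>s. (G s)\<^sup>2)" using G by (simp add: L2_density_def)
  then show "integrable lborel (\<lambda>s. (A * indicator {0..T} s + B * G s)\<^sup>2)"
    unfolding eq using integrable_indicator_Icc L2_density_integrable[OF G]
    by (intro Bochner_Integration.integrable_add integrable_mult_right) auto
qed (use G A in \<open>auto simp: L2_density_def\<close>)

text \<open>Expand the nonnegative integral of \<open>(G - m)^2\<close>, with \<open>m\<close> the
  mean of \<open>G\<close> over the interval. The mean needs a nondegenerate interval, so
  \<open>a = b\<close> is split off.\<close>

lemma L2_density_Cauchy_Schwarz:
  assumes G: "L2_density T G" and ab: "a \<le> b"
  shows "(LBINT s:{a..b}. G s)\<^sup>2 \<le> (b - a) * (LBINT s:{a..b}. (G s)\<^sup>2)"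
proof (cases "a = b")
  case True
  have "(LBINT s:{a..b}. G s) = integral {a..b} G"
    by (rule set_borel_integral_eq_integral(2)[OF L2_density_set_integrable(1)[OF G]])
  then show ?thesis using True by simp
next
  case False
  define I where "I = (LBINT s:{a..b}. G s)"
  define m where "m = I / (b - a)"
  note si = L2_density_set_integrable[OF G, of a b]
  have sc: "set_integrable lborel {a..b} (\<lambda>s. k)" for k :: real
    by (intro borel_integrable_atLeastAtMost') simp
  have "0 \<le> (LBINT s:{a..b}. (G s - m)\<^sup>2)"
    unfolding set_lebesgue_integral_def by (rule Bochner_Integration.integral_nonneg) simp
  also have "(LBINT s:{a..b}. (G s - m)\<^sup>2) = (LBINT s:{a..b}. ((G s)\<^sup>2 - (2 * m) * G s) + m\<^sup>2)"
    by (rule set_lebesgue_integral_cong) (auto simp: power2_diff algebra_simps)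
  also have "\<dots> = (LBINT s:{a..b}. (G s)\<^sup>2) - (2 * m) * I + m\<^sup>2 * (b - a)"
  proof -
    have "(LBINT s:{a..b}. m\<^sup>2) = m\<^sup>2 * (b - a)"
      using ab by (simp add: set_borel_integral_eq_integral(2)[OF sc])
    moreover have s2: "set_integrable lborel {a..b} (\<lambda>s. (2 * m) * G s)"
      by (rule set_integrable_mult_right) (rule si(1))
    moreover have "(LBINT s:{a..b}. (2 * m) * G s) = (2 * m) * I"
      unfolding I_def by (rule set_integral_mult_right)
    ultimately show ?thesis
      by (simp only: set_integral_add(2)[OF set_integral_diff(1)[OF si(2) s2] sc] set_integral_diff(2)[OF si(2) s2])
  qed
  also have "(2 * m) * I = 2 * (I\<^sup>2 / (b - a))" by (simp add: m_def power2_eq_square)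
  also have "m\<^sup>2 * (b - a) = I\<^sup>2 / (b - a)" using False by (simp add: m_def power2_eq_square)
  finally have "I\<^sup>2 / (b - a) \<le> (LBINT s:{a..b}. (G s)\<^sup>2)" by simp
  then show ?thesis using False ab by (simp add: I_def divide_le_eq mult.commute)
qed

text \<open>The majorant is the norm of the derivative, cut off outside \<open>{0..T}\<close>. This
  domination is all that later steps retain from the regularity of the centre
  \<open>c\<close>.\<close>

lemma H1_on_imp_dominated:
  fixes f :: "real \<Rightarrow> 'a::euclidean_space"
  assumes "H1_on T f"
  obtains G where "L2_density T G"
    "\<And>s t. 0 \<le> s \<Longrightarrow> s \<le> t \<Longrightarrow> t \<le> T \<Longrightarrow> dist (f t) (f s) \<le> (LBINT u:{s..t}. G u)"
proof -
  obtain g where g: "set_borel_measurable lborel {0..T} g" "set_integrable lborel {0..T} (\<lambda>s. (norm (g s))\<^sup>2)"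
      and f: "\<And>t. t \<in> {0..T} \<Longrightarrow> f t = f 0 + (LBINT s:{0..t}. g s)"
    using assms unfolding H1_on_def by blast
  define G where "G s = norm (indicator {0..T} s *\<^sub>R g s)" for s
  have Gm: "G \<in> borel_measurable borel"
  proof -
    have "(\<lambda>s. indicator {0..T} s *\<^sub>R g s) \<in> borel_measurable borel"
      using g(1) by (simp add: set_borel_measurable_def)
    from measurable_compose[OF this borel_measurable_norm] show ?thesis
      unfolding G_def[abs_def] .
  qed
  have G2: "(\<lambda>s. (G s)\<^sup>2) = (\<lambda>s. indicator {0..T} s *\<^sub>R (norm (g s))\<^sup>2)"
    by (auto simp: G_def indicator_def)
  have G: "L2_density T G"
    using g(2) Gm unfolding L2_density_def G2 by (auto simp: G_def set_integrable_def)
  have gi: "set_integrable lborel {0..T} g"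
    unfolding set_integrable_def
  proof (rule Bochner_Integration.integrable_bound[OF L2_density_integrable[OF G]])
    show "(\<lambda>s. indicator {0..T} s *\<^sub>R g s) \<in> borel_measurable lborel"
      using g(1) unfolding set_borel_measurable_def .
    show "AE s in lborel. norm (indicator {0..T} s *\<^sub>R g s) \<le> norm (G s)"
      unfolding G_def by simp
  qed
  have "dist (f t) (f s) \<le> (LBINT u:{s..t}. G u)" if st: "0 \<le> s" "s \<le> t" "t \<le> T" for s t
  proof -
    have gt: "set_integrable lborel {0..t} g" "set_integrable lborel {s..t} g"
      by (rule set_integrable_subset[OF gi]; use st in auto)+
    have "f t - f s = (LBINT u:{s..t}. g u)"
      using f[of t] f[of s] st set_integral_combine[OF gt(1) st(1,2)] by simp
    then have "dist (f t) (f s) \<le> (LBINT u:{s..t}. norm (g u))"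
      using set_integral_norm_bound[OF gt(2)] by (simp add: dist_norm)
    also have "\<dots> = (LBINT u:{s..t}. G u)"
      using st by (intro set_lebesgue_integral_cong) (auto simp: G_def)
    finally show ?thesis .
  qed
  then show thesis using G that by blast
qed

text \<open>The scalar result is applied to each coordinate. Summing the coordinate densities costs
  the factor \<open>DIM('a)\<close>, which does not affect square integrability.\<close>

lemma H1_on_if_dominated:
  fixes f :: "real \<Rightarrow> 'a::euclidean_space"
  assumes T: "0 \<le> T" and G: "L2_density T G"
    and f: "\<And>s t. 0 \<le> s \<Longrightarrow> s \<le> t \<Longrightarrow> t \<le> T \<Longrightarrow> dist (f t) (f s) \<le> (LBINT u:{s..t}. G u)"
  shows "H1_on T f"
proof -
  have G0: "0 \<le> G s" for s using G by (simp add: L2_density_def)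
  have "\<exists>g. g \<in> borel_measurable borel \<and> (AE s in lborel. \<bar>g s\<bar> \<le> G s) \<and>
      (\<forall>t\<in>{0..T}. f t \<bullet> b = f 0 \<bullet> b + (LBINT s:{0..t}. g s))" if b: "b \<in> Basis" for b
  proof -
    have "\<bar>f t \<bullet> b - f s \<bullet> b\<bar> \<le> (LBINT u:{s..t}. G u)" if "0 \<le> s" "s \<le> t" "t \<le> T" for s t
      using Basis_le_norm[OF b, of "f t - f s"] f[OF that] by (simp add: dist_norm inner_diff_left)
    moreover have "G s = 0" if "s \<notin> {0..T}" for s using G that by (simp add: L2_density_def)
    ultimately obtain g where "g \<in> borel_measurable borel" "AE s in lborel. \<bar>g s\<bar> \<le> G s"
        "\<And>t. t \<in> {0..T} \<Longrightarrow> f t \<bullet> b = f 0 \<bullet> b + (LBINT s:{0..t}. g s)"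
      using density_of_dominated_increments[OF T L2_density_integrable[OF G] G0, of "\<lambda>t. f t \<bullet> b"] by blast
    then show ?thesis by blast
  qed
  then obtain g where g: "\<And>b. b \<in> Basis \<Longrightarrow> g b \<in> borel_measurable borel"
      "\<And>b. b \<in> Basis \<Longrightarrow> AE s in lborel. \<bar>g b s\<bar> \<le> G s"
      "\<And>b t. b \<in> Basis \<Longrightarrow> t \<in> {0..T} \<Longrightarrow> f t \<bullet> b = f 0 \<bullet> b + (LBINT s:{0..t}. g b s)"
    by metis
  define h where "h s = (\<Sum>b\<in>Basis. g b s *\<^sub>R b)" for s
  have hm [measurable]: "h \<in> borel_measurable borel"
    unfolding h_def using g(1) by (intro borel_measurable_sum borel_measurable_scaleR) auto
  have "AE s in lborel. \<forall>b\<in>Basis. \<bar>g b s\<bar> \<le> G s"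
    using g(2) by (intro AE_finite_allI) auto
  then have hG: "AE s in lborel. norm (h s) \<le> real DIM('a) * G s"
  proof eventually_elim
    case (elim s)
    have "norm (h s) \<le> (\<Sum>b\<in>Basis. norm (g b s *\<^sub>R b))" unfolding h_def by (rule norm_sum)
    also have "\<dots> \<le> (\<Sum>b\<in>(Basis::'a set). G s)" using elim by (intro sum_mono) auto
    finally show ?case by simp
  qed
  have gi: "set_integrable lborel {0..t} (g b)" if "b \<in> Basis" for b t
    by (rule set_integrable_bound[OF L2_density_set_integrable(1)[OF G]])
       (use g(1,2)[OF that] G0 in \<open>auto simp: set_borel_measurable_def elim: eventually_mono\<close>)
  show ?thesis
    unfolding H1_on_def
  proof (intro exI conjI ballI)
    show "set_borel_measurable lborel {0..T} h" by (simp add: set_borel_measurable_def)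
    have "set_integrable lborel {0..T} (\<lambda>s. (real DIM('a))\<^sup>2 * (G s)\<^sup>2)"
      using L2_density_set_integrable(2)[OF G] by auto
    then show "set_integrable lborel {0..T} (\<lambda>s. (norm (h s))\<^sup>2)"
    proof (rule set_integrable_bound)
      show "AE s in lborel. s \<in> {0..T} \<longrightarrow> norm ((norm (h s))\<^sup>2) \<le> norm ((real DIM('a))\<^sup>2 * (G s)\<^sup>2)"
        using hG
      proof eventually_elim
        case (elim s)
        then have "(norm (h s))\<^sup>2 \<le> (real DIM('a) * G s)\<^sup>2" by (intro power_mono) auto
        then show ?case by (simp add: power_mult_distrib)
      qed
    qed (simp add: set_borel_measurable_def)
    fix t assume t: "t \<in> {0..T}"
    have "(LBINT s:{0..t}. h s) = (\<Sum>b\<in>Basis. (LBINT s:{0..t}. g b s) *\<^sub>R b)"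
      using gi unfolding h_def set_lebesgue_integral_def set_integrable_def
      by (simp add: scaleR_sum_right integral_sum)
    also have "\<dots> = (\<Sum>b\<in>Basis. ((f t - f 0) \<bullet> b) *\<^sub>R b)"
      using g(3)[OF _ t] by (intro sum.cong) (auto simp: inner_diff_left)
    also have "\<dots> = f t - f 0" by (rule euclidean_representation)
    finally show "f t = f 0 + (LBINT s:{0..t}. h s)" by simp
  qed
qed

lemma continuous_on_L2_density_primitive:
  assumes "L2_density T G"
  shows "continuous_on {0..T} (\<lambda>t. LBINT u:{0..t}. G u)"
proof -
  note si = L2_density_set_integrable(1)[OF assms]
  have "continuous_on {0..T} (\<lambda>t. integral {0..t} G)"
    by (rule indefinite_integral_continuous_1) (rule set_borel_integral_eq_integral(1)[OF si])
  then show ?thesis by (simp add: set_borel_integral_eq_integral(2)[OF si])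
qed

lemma continuous_on_if_dominated:
  fixes f :: "real \<Rightarrow> 'a::metric_space"
  assumes G: "L2_density T G"
    and f: "\<And>s t. 0 \<le> s \<Longrightarrow> s \<le> t \<Longrightarrow> t \<le> T \<Longrightarrow> dist (f t) (f s) \<le> (LBINT u:{s..t}. G u)"
  shows "continuous_on {0..T} f"
proof -
  define \<Gamma> where "\<Gamma> t = (LBINT u:{0..t}. G u)" for t
  have \<Gamma>c: "continuous_on {0..T} \<Gamma>"
    unfolding \<Gamma>_def by (rule continuous_on_L2_density_primitive[OF G])
  have le: "dist (f t) (f s) \<le> \<Gamma> t - \<Gamma> s" if "0 \<le> s" "s \<le> t" "t \<le> T" for s t
    using f[OF that] set_integral_combine[OF L2_density_set_integrable(1)[OF G] that(1,2)] by (simp add: \<Gamma>_def)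
  have le': "dist (f t) (f s) \<le> dist (\<Gamma> t) (\<Gamma> s)" if "s \<in> {0..T}" "t \<in> {0..T}" for s t
    using le[of s t] le[of t s] that by (cases "s \<le> t") (auto simp: dist_commute dist_real_def)
  show ?thesis
    unfolding continuous_on_iff
  proof (intro ballI allI impI)
    fix s and e :: real assume s: "s \<in> {0..T}" and "0 < e"
    then obtain d where "0 < d" "\<And>t. t \<in> {0..T} \<Longrightarrow> dist t s < d \<Longrightarrow> dist (\<Gamma> t) (\<Gamma> s) < e"
      using \<Gamma>c unfolding continuous_on_iff by meson
    then show "\<exists>d>0. \<forall>t\<in>{0..T}. dist t s < d \<longrightarrow> dist (f t) (f s) < e"
      using le'[OF s] by (metis le_less_trans)
  qed
qed

section \<open>Projections and the scheme\<close>

lemma closest_point_cball_translation: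
  fixes c m :: "'a::euclidean_space"
  assumes "0 \<le> r"
  shows "closest_point (cball c r) m = c + closest_point (cball 0 r) (m - c)"
proof (rule closest_point_unique[symmetric])
  have ne: "cball (0::'a) r \<noteq> {}" using assms by simp
  have in0: "closest_point (cball 0 r) (m - c) \<in> cball 0 r"
    by (rule closest_point_in_set[OF closed_cball ne])
  then show "c + closest_point (cball 0 r) (m - c) \<in> cball c r" by (simp add: dist_norm)
  show "\<forall>z\<in>cball c r. dist m (c + closest_point (cball 0 r) (m - c)) \<le> dist m z"
  proof
    fix z assume "z \<in> cball c r"
    then have "z - c \<in> cball 0 r" by (simp add: dist_norm norm_minus_commute)
    from closest_point_le[OF closed_cball this, of "m - c"]
    show "dist m (c + closest_point (cball 0 r) (m - c)) \<le> dist m z"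
      by (simp add: dist_norm algebra_simps)
  qed
qed auto

text \<open>After moving both centres to 0 the projection is nonexpansive. The displacement of the
  centre is paid once in the shifted argument and once when translating back.\<close>

lemma dist_closest_point_cball_le:
  fixes c m :: "'a::euclidean_space"
  assumes "0 \<le> r"
  shows "dist (closest_point (cball c r) m) (closest_point (cball d r) n) \<le> dist m n + 2 * dist c d"
proof -
  have "dist (closest_point (cball (0::'a) r) (m - c)) (closest_point (cball 0 r) (n - d)) \<le> dist (m - c) (n - d)"
    using assms by (intro closest_point_lipschitz) auto
  moreover have "dist (m - c) (n - d) \<le> dist m n + dist c d"
    using norm_triangle_ineq4[of "m - n" "c - d"] by (simp add: dist_norm algebra_simps)
  moreover have "dist (closest_point (cball c r) m) (closest_point (cball d r) n)
      \<le> dist c d + dist (closest_point (cball 0 r) (m - c)) (closest_point (cball 0 r) (n - d))"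
    unfolding closest_point_cball_translation[OF assms, of c m] closest_point_cball_translation[OF assms, of d n]
    by (rule dist_triangle_add)
  ultimately show ?thesis by simp
qed

section \<open>Minimisers of quadratics and the projection form of the scheme\<close>

text \<open>\<open>arg_min\<close> is a choice operator, so its value is meaningful only once a
  minimiser is known to exist; the projection of \<open>m\<close> is one. The case
  \<open>a = 0\<close>, where \<open>f\<close> is constant, is kept on purpose.\<close>

lemma arg_min_quadratic_mem:
  fixes f :: "'a::euclidean_space \<Rightarrow> real"
  assumes S: "closed S" "S \<noteq> {}" and a: "0 \<le> a" and f: "\<And>W. f W = a * (norm (W - m))\<^sup>2 + k"
  shows "is_arg_min f (\<lambda>W. W \<in> S) (arg_min f (\<lambda>W. W \<in> S))"
  unfolding arg_min_def
proof (rule someI)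
  have "f (closest_point S m) \<le> f y" if "y \<in> S" for y
    using closest_point_le[OF S(1) that, of m] a unfolding f
    by (intro add_right_mono mult_left_mono power_mono) (auto simp: dist_norm norm_minus_commute)
  then show "is_arg_min f (\<lambda>W. W \<in> S) (closest_point S m)"
    by (auto simp: is_arg_min_linorder closest_point_in_set[OF S])
qed

text \<open>For \<open>a > 0\<close> minimising \<open>f\<close> is minimising the distance to
  \<open>m\<close>, and uniqueness of the closest point in a closed convex set makes the choice
  unambiguous.\<close>

lemma arg_min_quadratic:
  fixes f :: "'a::euclidean_space \<Rightarrow> real"
  assumes S: "closed S" "convex S" "S \<noteq> {}" and a: "0 < a" and f: "\<And>W. f W = a * (norm (W - m))\<^sup>2 + k"
  shows "arg_min f (\<lambda>W. W \<in> S) = closest_point S m"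
proof (rule closest_point_unique[OF S(2,1)])
  have *: "is_arg_min f (\<lambda>W. W \<in> S) (arg_min f (\<lambda>W. W \<in> S))"
    using arg_min_quadratic_mem[OF S(1,3) less_imp_le[OF a] f] .
  then show "arg_min f (\<lambda>W. W \<in> S) \<in> S" by (simp add: is_arg_min_def)
  show "\<forall>z\<in>S. dist m (arg_min f (\<lambda>W. W \<in> S)) \<le> dist m z"
  proof
    fix z assume "z \<in> S"
    then have "f (arg_min f (\<lambda>W. W \<in> S)) \<le> f z" using * by (simp add: is_arg_min_linorder)
    then show "dist m (arg_min f (\<lambda>W. W \<in> S)) \<le> dist m z"
      using a by (simp add: f dist_norm norm_minus_commute)
  qed
qed

text \<open>Subtracting the constant past \<open>x\<close> leaves only finitely many terms of the sum over the history.\<close>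

definition memory :: "(real \<Rightarrow> real) \<Rightarrow> (real \<Rightarrow> 'a::euclidean_space set) \<Rightarrow> 'a \<Rightarrow> real \<Rightarrow> nat \<Rightarrow> 'a" where
  "memory \<rho> K x h n = (\<Sum>j<n. weight \<rho> h (j + 1) *\<^sub>R (scheme \<rho> K x h (n - (j + 1)) - x))"

text \<open>The case \<open>S = 0\<close> is harmless: then all the weights in the memory vanish, so both sides reduce
  to constants.\<close>

lemma scheme_functional:
  fixes x :: "'a::euclidean_space"
  assumes w: "summable (\<lambda>j. weight \<rho> h (j + 1))" "\<And>j. 0 \<le> weight \<rho> h j"
  defines "S \<equiv> (\<Sum>j. weight \<rho> h (j + 1))"
  obtains k where "\<And>W. h / 2 * (\<Sum>j. (norm (W - (if j < n then scheme \<rho> K x h (n - (j + 1)) else x)))\<^sup>2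
                          * weight \<rho> h (j + 1))
     = (h / 2 * S) * (norm (W - (x + (1 / S) *\<^sub>R memory \<rho> K x h n)))\<^sup>2 + k"
proof -
  define U where "U j = scheme \<rho> K x h (n - (j + 1)) - x" for j
  define w where "w j = weight \<rho> h (j + 1)" for j
  define V where "V = memory \<rho> K x h n"
  define Q where "Q = (\<Sum>j<n. w j * (norm (U j))\<^sup>2)"
  have V: "V = (\<Sum>j<n. w j *\<^sub>R U j)" by (simp add: V_def memory_def w_def U_def)
  have wS: "w sums S" using summable_sums[OF assms(1)] unfolding w_def S_def .
  have SV: "S *\<^sub>R (1 / S) *\<^sub>R V = V"
  proof (cases "S = 0")
    case True
    then have "w j = 0" for j
      using suminf_eq_zero_iff[OF sums_summable[OF wS]] sums_unique[OF wS] assms(2) by (auto simp: w_def)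
    then show ?thesis by (simp add: V)
  qed simp
  \<comment> \<open>Completing the square. Relative to the constant past only the terms with
    \<open>j < n\<close> deviate, so the series is \<open>S * |W - x|^2\<close> plus a finite sum;
    its cross term \<open>V\<close> is absorbed because
    \<open>S *\<^sub>R (1 / S) *\<^sub>R V = V\<close>.\<close>
  have "(\<Sum>j. (norm (W - (if j < n then scheme \<rho> K x h (n - (j + 1)) else x)))\<^sup>2 * weight \<rho> h (j + 1))
      = S * (norm (W - (x + (1 / S) *\<^sub>R V)))\<^sup>2 + (Q - S * (norm ((1 / S) *\<^sub>R V))\<^sup>2)" for W
  proof -
    have "(norm (W - (if j < n then scheme \<rho> K x h (n - (j + 1)) else x)))\<^sup>2 * weight \<rho> h (j + 1)
        = (norm (W - x))\<^sup>2 * w j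
          + (if j \<in> {..<n} then w j * ((norm (U j))\<^sup>2 - 2 * ((W - x) \<bullet> U j)) else 0)" for j
    proof (cases "j < n")
      case True
      have e: "(norm (W - scheme \<rho> K x h (n - (j + 1))))\<^sup>2 = (norm (W - x))\<^sup>2 + (norm (U j))\<^sup>2 - 2 * ((W - x) \<bullet> U j)"
        unfolding U_def power2_norm_eq_inner
        by (simp add: inner_diff_left inner_diff_right inner_commute)
      show ?thesis using True by (simp only: e w_def if_True lessThan_iff) (simp add: algebra_simps)
    qed (simp add: w_def)
    moreover have "(\<lambda>j. (norm (W - x))\<^sup>2 * w j
          + (if j \<in> {..<n} then w j * ((norm (U j))\<^sup>2 - 2 * ((W - x) \<bullet> U j)) else 0))
        sums ((norm (W - x))\<^sup>2 * S + (\<Sum>j<n. w j * ((norm (U j))\<^sup>2 - 2 * ((W - x) \<bullet> U j))))"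
      by (intro sums_add sums_mult wS sums_If_finite_set) simp
    moreover have "(\<Sum>j<n. w j * ((norm (U j))\<^sup>2 - 2 * ((W - x) \<bullet> U j))) = Q - 2 * ((W - x) \<bullet> V)"
      by (simp add: V Q_def inner_sum_right right_diff_distrib sum_subtractf sum_distrib_left mult.left_commute)
    ultimately have "(\<Sum>j. (norm (W - (if j < n then scheme \<rho> K x h (n - (j + 1)) else x)))\<^sup>2 * weight \<rho> h (j + 1))
      = (norm (W - x))\<^sup>2 * S + (Q - 2 * ((W - x) \<bullet> V))"
      by (simp add: sums_iff)
    moreover have "S * (norm (W - (x + b)))\<^sup>2 = S * (norm (W - x))\<^sup>2 - 2 * ((W - x) \<bullet> (S *\<^sub>R b)) + S * (norm b)\<^sup>2" for b
      unfolding power2_norm_eq_inner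
      by (simp add: algebra_simps inner_diff_left inner_diff_right inner_add_left inner_add_right inner_commute)
    from this[of "(1 / S) *\<^sub>R V"] have "S * (norm (W - (x + (1 / S) *\<^sub>R V)))\<^sup>2
        = S * (norm (W - x))\<^sup>2 - 2 * ((W - x) \<bullet> V) + S * (norm ((1 / S) *\<^sub>R V))\<^sup>2"
      unfolding SV .
    ultimately show ?thesis by (simp add: algebra_simps)
  qed
  then show thesis
    by (intro that[of "h / 2 * (Q - S * (norm ((1 / S) *\<^sub>R V))\<^sup>2)"]) (simp add: V_def distrib_left)
qed

text \<open>Membership needs only a nonnegative total weight, so it is available for every step
  size; the projection formula needs a positive one.\<close>

lemma
  fixes x :: "'a::euclidean_space"
  assumes h: "0 < h" and w: "summable (\<lambda>j. weight \<rho> h (j + 1))" "\<And>j. 0 \<le> weight \<rho> h j"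
    and K: "closed (K (real n * h))" "convex (K (real n * h))" "K (real n * h) \<noteq> {}"
  shows scheme_mem: "scheme \<rho> K x h n \<in> K (real n * h)"
    and scheme_eq_closest_point: "0 < (\<Sum>j. weight \<rho> h (j + 1)) \<Longrightarrow> scheme \<rho> K x h n
      = closest_point (K (real n * h)) (x + (1 / (\<Sum>j. weight \<rho> h (j + 1))) *\<^sub>R memory \<rho> K x h n)"
proof -
  let ?S = "\<Sum>j. weight \<rho> h (j + 1)"
  obtain k where k: "\<And>W. h / 2 * (\<Sum>j. (norm (W - (if j < n then scheme \<rho> K x h (n - (j + 1)) else x)))\<^sup>2
                          * weight \<rho> h (j + 1))
     = (h / 2 * ?S) * (norm (W - (x + (1 / ?S) *\<^sub>R memory \<rho> K x h n)))\<^sup>2 + k"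
    using scheme_functional[OF w, of n K x] by blast
  have "0 \<le> ?S" by (rule suminf_nonneg[OF w(1)]) (rule w(2))
  then have S0: "0 \<le> h / 2 * ?S" using h by simp
  show "scheme \<rho> K x h n \<in> K (real n * h)"
    using arg_min_quadratic_mem[OF K(1,3) S0 k] unfolding scheme.simps[of \<rho> K x h n] is_arg_min_def by blast
  assume "0 < ?S"
  then have "0 < h / 2 * ?S" using h by simp
  then show "scheme \<rho> K x h n = closest_point (K (real n * h)) (x + (1 / ?S) *\<^sub>R memory \<rho> K x h n)"
    using arg_min_quadratic[OF K _ k] unfolding scheme.simps[of \<rho> K x h n] by blast
qed

section \<open>The one-step estimate\<close>

text \<open>The two halves of \<open>2 * B * R 1\<close> come from the newly entered term
  \<open>R 1 *\<^sub>R U n\<close> and from the decrements of the older coefficients, whose sum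
  \<open>R 1 - R (n + 1)\<close> does not grow with \<open>n\<close>.\<close>

lemma norm_convolution_increment_le:
  fixes U :: "nat \<Rightarrow> 'a::real_normed_vector" and R :: "nat \<Rightarrow> real"
  assumes R: "decseq R" "\<And>j. 0 \<le> R j" and U: "\<And>i. i \<le> n \<Longrightarrow> norm (U i) \<le> B"
  shows "norm ((\<Sum>j<n+1. R (j + 1) *\<^sub>R U (n + 1 - (j + 1))) - (\<Sum>j<n. R (j + 1) *\<^sub>R U (n - (j + 1)))) \<le> 2 * B * R 1"
proof -
  have B: "0 \<le> B" using U[of 0] norm_ge_zero[of "U 0"] by linarith
  \<comment> \<open>Summing over time instead of lag puts the same \<open>U i\<close> into both
    convolutions, with coefficient \<open>R (n - i)\<close> before the step and
    \<open>R (n + 1 - i)\<close> after it.\<close>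
  have *: "(\<Sum>j<n. R (j + 1) *\<^sub>R U (n - (j + 1))) = (\<Sum>i<n. R (n - i) *\<^sub>R U i)" for n
  proof -
    have "(\<Sum>j<n. R (j + 1) *\<^sub>R U (n - (j + 1))) = (\<Sum>j<n. R (n - (n - Suc j)) *\<^sub>R U (n - Suc j))"
      by (intro sum.cong) auto
    also have "\<dots> = (\<Sum>i<n. R (n - i) *\<^sub>R U i)"
      by (rule sum.nat_diff_reindex)
    finally show ?thesis .
  qed
  have dec: "R (n + 1 - i) \<le> R (n - i)" for i using R(1) by (auto simp: decseq_def)
  have "(\<Sum>j<n+1. R (j + 1) *\<^sub>R U (n + 1 - (j + 1))) - (\<Sum>j<n. R (j + 1) *\<^sub>R U (n - (j + 1)))
      = R 1 *\<^sub>R U n - (\<Sum>i<n. (R (n - i) - R (n + 1 - i)) *\<^sub>R U i)"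
    unfolding * by (simp add: scaleR_diff_left sum_subtractf)
  also have "norm \<dots> \<le> norm (R 1 *\<^sub>R U n) + norm (\<Sum>i<n. (R (n - i) - R (n + 1 - i)) *\<^sub>R U i)"
    by (rule norm_triangle_ineq4)
  also have "\<dots> \<le> R 1 * B + (\<Sum>i<n. (R (n - i) - R (n + 1 - i)) * B)"
    using dec R(2) U by (intro add_mono order_trans[OF norm_sum] sum_mono) (auto intro!: mult_left_mono)
  also have "(\<Sum>i<n. (R (n - i) - R (n + 1 - i)) * B) = (\<Sum>i<n. R (n - i) - R (n + 1 - i)) * B"
    by (simp add: sum_distrib_right)
  also have "(\<Sum>i<n. R (n - i) - R (n + 1 - i)) = R 1 - R (n + 1)"
  proof -
    have "(\<Sum>i<n. R (n - i) - R (n + 1 - i)) = (\<Sum>j<n. R (n - (n - Suc j)) - R (n + 1 - (n - Suc j)))"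
      by (rule sum.nat_diff_reindex[symmetric])
    also have "\<dots> = (\<Sum>j<n. R (Suc j) - R (Suc (Suc j)))"
      by (intro sum.cong) (auto simp: Suc_diff_Suc Suc_diff_le)
    also have "\<dots> = R 1 - R (n + 1)"
      by (subst sum_lessThan_telescope') simp
    finally show ?thesis .
  qed
  also have "R 1 * B + (R 1 - R (n + 1)) * B \<le> 2 * B * R 1"
    using B R(2)[of "n + 1"] by (simp add: algebra_simps)
  finally show ?thesis .
qed

text \<open>Dropping lag 0 from the unit mass leaves \<open>1 - h R_0\<close>; this defect is the
  normalisation of the barycentre.\<close>

lemma weight_tail_sums:
  assumes "0 < h" and "(\<lambda>j. h * weight \<rho> h j) sums 1"
  shows "(\<lambda>j. weight \<rho> h (j + 1)) sums ((1 - h * weight \<rho> h 0) / h)"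
proof -
  have "weight \<rho> h sums (1 / h)"
    using sums_mult[OF assms(2), of "1 / h"] assms(1) by simp
  then show ?thesis using assms(1) by (simp add: sums_Suc_iff diff_divide_distrib)
qed

text \<open>If \<open>h R_0 <= 1/2\<close>, the total weight is at least \<open>1 / (2 h)\<close>,
  so dividing the memory increment \<open>2 B R_1\<close> by it costs at most
  \<open>4 B R_0 h\<close>. Otherwise the step itself is not small and the trivial bound
  \<open>2 B\<close> suffices.\<close>

lemma scheme_increment_le:
  fixes x :: "'a::euclidean_space" and c :: "real \<Rightarrow> 'a"
  assumes h: "0 < h" and r: "0 \<le> r" and w: "(\<lambda>j. h * weight \<rho> h j) sums 1" "\<And>j. 0 \<le> weight \<rho> h j" "decseq (weight \<rho> h)"
  defines "X \<equiv> scheme \<rho> (\<lambda>t. cball (c t) r) x h"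
  assumes B: "\<And>i. i \<le> n + 1 \<Longrightarrow> norm (X i - x) \<le> B"
  shows "dist (X (n + 1)) (X n) \<le> 4 * B * weight \<rho> h 0 * h + 2 * dist (c (real (n + 1) * h)) (c (real n * h))"
proof -
  let ?S = "\<Sum>j. weight \<rho> h (j + 1)"
  have B0: "0 \<le> B" using B[of 0] norm_ge_zero[of "X 0 - x"] by linarith
  note s1 = weight_tail_sums[OF h w(1)]
  note sm = sums_summable[OF s1] and S = sums_unique[OF s1, symmetric]
  show ?thesis
  proof (cases "h * weight \<rho> h 0 \<le> 1 / 2")
    case True
    then have Sge: "1 / (2 * h) \<le> ?S" unfolding S using h by (simp add: field_simps)
    then have Spos: "0 < ?S" using h by (auto intro: less_le_trans[rotated])
    have X: "X i = closest_point (cball (c (real i * h)) r) (x + (1 / ?S) *\<^sub>R memory \<rho> (\<lambda>t. cball (c t) r) x h i)" for i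
      unfolding X_def by (rule scheme_eq_closest_point[OF h sm w(2) _ _ _ Spos]) (use r in auto)
    have "dist (X (n + 1)) (X n) \<le> dist (x + (1 / ?S) *\<^sub>R memory \<rho> (\<lambda>t. cball (c t) r) x h (n + 1))
       (x + (1 / ?S) *\<^sub>R memory \<rho> (\<lambda>t. cball (c t) r) x h n) + 2 * dist (c (real (n + 1) * h)) (c (real n * h))"
      unfolding X[of "n + 1"] X[of n] by (rule dist_closest_point_cball_le[OF r])
    also have "dist (x + (1 / ?S) *\<^sub>R memory \<rho> (\<lambda>t. cball (c t) r) x h (n + 1)) (x + (1 / ?S) *\<^sub>R memory \<rho> (\<lambda>t. cball (c t) r) x h n)
       = (1 / ?S) * norm (memory \<rho> (\<lambda>t. cball (c t) r) x h (n + 1) - memory \<rho> (\<lambda>t. cball (c t) r) x h n)"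
      using Spos by (simp add: dist_norm flip: scaleR_diff_right)
    also have "\<dots> \<le> (2 * h) * (2 * B * weight \<rho> h 0)"
    proof (rule mult_mono)
      show "1 / ?S \<le> 2 * h" using Sge Spos h by (simp add: field_simps)
      have "norm (memory \<rho> (\<lambda>t. cball (c t) r) x h (n + 1) - memory \<rho> (\<lambda>t. cball (c t) r) x h n) \<le> 2 * B * weight \<rho> h 1"
        using norm_convolution_increment_le[OF w(3,2), of n "\<lambda>i. X i - x" B] B unfolding memory_def X_def by simp
      also have "\<dots> \<le> 2 * B * weight \<rho> h 0"
        using w(3) B0 by (intro mult_left_mono) (auto simp: decseq_def)
      finally show "norm (memory \<rho> (\<lambda>t. cball (c t) r) x h (n + 1) - memory \<rho> (\<lambda>t. cball (c t) r) x h n) \<le> 2 * B * weight \<rho> h 0" .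
    qed (use h in auto)
    finally show ?thesis by (simp add: mult_ac)
  next
    case False
    \<comment> \<open>For such large steps the bound by the diameter is already of order \<open>h\<close>.\<close>
    have "dist (X (n + 1)) (X n) \<le> norm (X (n + 1) - x) + norm (X n - x)"
      using dist_triangle2[of "X (n + 1)" "X n" x] by (simp add: dist_norm)
    also have "\<dots> \<le> 2 * B" using B[of n] B[of "n + 1"] by simp
    also have "\<dots> \<le> 4 * B * (h * weight \<rho> h 0)"
      using False B0 mult_left_mono[of "1 / 2" "h * weight \<rho> h 0" "4 * B"] by simp
    finally show ?thesis by (simp add: mult_ac add_increasing2)
  qed
qed

section \<open>Interpolation and compactness\<close>

lemma nat_floor_mult_bounds:
  fixes h t :: real
  assumes "0 < h" "0 \<le> t"
  shows "real (nat \<lfloor>t / h\<rfloor>) * h \<le> t" and "t < (real (nat \<lfloor>t / h\<rfloor>) + 1) * h"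
proof -
  have "real (nat \<lfloor>t / h\<rfloor>) = of_int \<lfloor>t / h\<rfloor>" using assms by simp
  then have "real (nat \<lfloor>t / h\<rfloor>) \<le> t / h" "t / h < real (nat \<lfloor>t / h\<rfloor>) + 1" by linarith+
  then show "real (nat \<lfloor>t / h\<rfloor>) * h \<le> t" "t < (real (nat \<lfloor>t / h\<rfloor>) + 1) * h"
    using assms(1) by (simp_all add: field_simps)
qed

lemma nat_floor_divide_eq:
  fixes h t :: real
  assumes "0 < h" "real n * h \<le> t" "t < (real n + 1) * h"
  shows "nat \<lfloor>t / h\<rfloor> = n"
proof -
  have "\<lfloor>t / h\<rfloor> = int n" using assms by (intro floor_unique) (auto simp: field_simps)
  then show ?thesis by simp
qed

lemma interpolant_node:
  assumes "0 < h"
  shows "interpolant h Y (real n * h) = Y n"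
  using nat_floor_divide_eq[of h n "real n * h"] assms by (simp add: interpolant_def Let_def)

text \<open>At the right endpoint the floor already selects the next cell, but both affine formulas
  give the value \<open>Y (n + 1)\<close> there.\<close>

lemma interpolant_eq:
  assumes h: "0 < h" and t: "real n * h \<le> t" "t \<le> (real n + 1) * h"
  shows "interpolant h Y t = Y n + ((t - real n * h) / h) *\<^sub>R (Y (n + 1) - Y n)"
proof (cases "t < (real n + 1) * h")
  case True
  then show ?thesis using nat_floor_divide_eq[OF h t(1)] by (simp add: interpolant_def Let_def)
next
  case False
  then have "t = real (n + 1) * h" using t(2) by (simp add: algebra_simps)
  then show ?thesis using h interpolant_node[OF h, of Y "n + 1"] by (simp add: algebra_simps)
qed

text \<open>On a cell the increment is \<open>(t - s) / h\<close> times that of the nodes, and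
  \<open>(t - s) / h * sqrt h <= sqrt (t - s)\<close> as long as \<open>t - s <= h\<close>.\<close>

lemma dist_interpolant_le_cell:
  fixes Y :: "nat \<Rightarrow> 'a::euclidean_space"
  assumes h: "0 < h" and st: "real n * h \<le> s" "s \<le> t" "t \<le> (real n + 1) * h"
    and Y: "dist (Y (n + 1)) (Y n) \<le> A * sqrt h"
  shows "dist (interpolant h Y t) (interpolant h Y s) \<le> A * sqrt (t - s)"
proof -
  have "0 \<le> A * sqrt h" using Y zero_le_dist order_trans by blast
  then have A: "0 \<le> A" using h by (simp add: zero_le_mult_iff)
  have "interpolant h Y t - interpolant h Y s = ((t - s) / h) *\<^sub>R (Y (n + 1) - Y n)"
    using interpolant_eq[OF h, of n t Y] interpolant_eq[OF h, of n s Y] st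
    by (simp add: scaleR_diff_left[symmetric] diff_divide_distrib del: scaleR_diff_right)
  then have "dist (interpolant h Y t) (interpolant h Y s) = ((t - s) / h) * dist (Y (n + 1)) (Y n)"
    using st h by (simp add: dist_norm)
  also have "\<dots> \<le> ((t - s) / h) * (A * sqrt h)"
    using st h Y by (intro mult_left_mono) auto
  also have "\<dots> = A * (sqrt (t - s) * (sqrt (t - s) / sqrt h))"
    using st h by (simp add: field_simps)
  also have "\<dots> \<le> A * (sqrt (t - s) * 1)"
    using A st h by (intro mult_left_mono) (auto simp: algebra_simps)
  finally show ?thesis by simp
qed

text \<open>The factor 3 counts the pieces of \<open>[s, t]\<close>: the rest of the cell of
  \<open>s\<close>, the full cells, and the beginning of the cell of \<open>t\<close>.\<close>

lemma dist_interpolant_le: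
  fixes Y :: "nat \<Rightarrow> 'a::euclidean_space"
  assumes h: "0 < h" and A: "0 \<le> A"
    and Y: "\<And>m n. m \<le> n \<Longrightarrow> n \<le> N \<Longrightarrow> dist (Y n) (Y m) \<le> A * sqrt ((real n - real m) * h)"
    and st: "0 \<le> s" "s \<le> t" "t \<le> real N * h"
  shows "dist (interpolant h Y t) (interpolant h Y s) \<le> 3 * A * sqrt (t - s)"
proof -
  define p where "p = nat \<lfloor>s / h\<rfloor>"
  define q where "q = nat \<lfloor>t / h\<rfloor>"
  have p: "real p * h \<le> s" "s < (real p + 1) * h"
    unfolding p_def by (rule nat_floor_mult_bounds; use h st in simp)+
  have q: "real q * h \<le> t" "t < (real q + 1) * h"
    unfolding q_def by (rule nat_floor_mult_bounds; use h st in simp)+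
  have "real q * h \<le> real N * h" using q st by linarith
  then have qN: "q \<le> N" using h by simp
  have step: "dist (Y (n + 1)) (Y n) \<le> A * sqrt h" if "n < N" for n
    using Y[of n "n + 1"] that by simp
  have right: "dist (interpolant h Y t) (interpolant h Y u) \<le> A * sqrt (t - s)"
    if u: "real q * h \<le> u" "u \<le> t" "s \<le> u" for u
  \<comment> \<open>For \<open>q = N\<close> the point \<open>t\<close> is the last node and nothing
    is known about \<open>Y (N + 1)\<close>; but then \<open>u = t\<close>.\<close>
  proof (cases "q < N")
    case True
    have "dist (interpolant h Y t) (interpolant h Y u) \<le> A * sqrt (t - u)"
      by (rule dist_interpolant_le_cell[OF h]) (use q u step[OF True] in auto)
    also have "\<dots> \<le> A * sqrt (t - s)" using u A by (intro mult_left_mono) auto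
    finally show ?thesis .
  next
    case False
    then have "u = t" using qN st q u by simp
    then show ?thesis using A st by simp
  qed
  have nn: "0 \<le> A * sqrt (t - s)" using A st by simp
  have "real p * h < (real q + 1) * h" using p q st by linarith
  then have "p \<le> q" using h by simp
  then consider "p = q" | "p + 1 \<le> q" by linarith
  then show ?thesis
  proof cases
    case 1
    then show ?thesis using right[of s] p st nn by simp
  next
    case 2
    have q1: "real (p + 1) * h \<le> real q * h" using 2 h by (intro mult_right_mono) auto
    have "dist (interpolant h Y (real (p + 1) * h)) (interpolant h Y s) \<le> A * sqrt (real (p + 1) * h - s)"
      by (rule dist_interpolant_le_cell[OF h]) (use p 2 qN step[of p] in \<open>auto simp: algebra_simps\<close>)
    also have "\<dots> \<le> A * sqrt (t - s)" using A q1 q by (intro mult_left_mono) auto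
    finally have 1: "dist (interpolant h Y (real (p + 1) * h)) (interpolant h Y s) \<le> A * sqrt (t - s)" .
    have "dist (Y q) (Y (p + 1)) \<le> A * sqrt ((real q - real (p + 1)) * h)" using Y 2 qN by blast
    also have "\<dots> \<le> A * sqrt (t - s)"
      using A p q by (intro mult_left_mono) (auto simp: algebra_simps)
    finally have 2: "dist (interpolant h Y (real q * h)) (interpolant h Y (real (p + 1) * h)) \<le> A * sqrt (t - s)"
      by (simp only: interpolant_node[OF h])
    have "s \<le> real q * h" using p q1 by (simp add: algebra_simps)
    then have 3: "dist (interpolant h Y t) (interpolant h Y (real q * h)) \<le> A * sqrt (t - s)"
      using right[of "real q * h"] q by simp
    have "dist (interpolant h Y t) (interpolant h Y s) \<le> dist (interpolant h Y t) (interpolant h Y (real q * h))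
       + dist (interpolant h Y (real q * h)) (interpolant h Y (real (p + 1) * h))
       + dist (interpolant h Y (real (p + 1) * h)) (interpolant h Y s)"
      by metric
    then show ?thesis using 1 2 3 by linarith
  qed
qed

text \<open>Iterates are values of interpolants at nodes that move with \<open>k\<close>; this is
  what lets them pass to the limit.\<close>

lemma uniform_limit_tendsto_compose:
  fixes g :: "'a::metric_space \<Rightarrow> 'b::metric_space"
  assumes u: "uniform_limit S f g F" and c: "continuous_on S g"
    and \<tau>: "(\<tau> \<longlongrightarrow> t) F" "t \<in> S" "\<forall>\<^sub>F k in F. \<tau> k \<in> S"
  shows "((\<lambda>k. f k (\<tau> k)) \<longlongrightarrow> g t) F"
proof (rule tendstoI)
  fix e :: real assume "0 < e"
  then have e: "0 < e / 2" by simp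
  have "((\<lambda>k. g (\<tau> k)) \<longlongrightarrow> g t) F"
    by (rule continuous_on_tendsto_compose[OF c \<tau>])
  from tendstoD[OF this e] uniform_limitD[OF u e] \<tau>(3)
  show "\<forall>\<^sub>F k in F. dist (f k (\<tau> k)) (g t) < e"
  proof eventually_elim
    case (elim k)
    then have "dist (f k (\<tau> k)) (g (\<tau> k)) < e / 2" by blast
    then show ?case using elim(1) dist_triangle[of "f k (\<tau> k)" "g t" "g (\<tau> k)"] by simp
  qed
qed

lemma dist_sequence_le_integral:
  fixes Y :: "nat \<Rightarrow> 'a::metric_space"
  assumes h: "0 < h" and G: "L2_density T G"
    and Y: "\<And>n. n < N \<Longrightarrow> dist (Y (n + 1)) (Y n) \<le> (LBINT u:{real n * h..real (n + 1) * h}. G u)"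
    and mn: "m \<le> n" "n \<le> N"
  shows "dist (Y n) (Y m) \<le> (LBINT u:{real m * h..real n * h}. G u)"
  using mn
proof (induction n rule: dec_induct)
  case base
  have "0 \<le> (LBINT u:{real m * h..real m * h}. G u)"
    unfolding set_lebesgue_integral_def
    using G by (intro Bochner_Integration.integral_nonneg) (auto simp: L2_density_def)
  then show ?case by simp
next
  case (step n)
  have "dist (Y (Suc n)) (Y m) \<le> dist (Y (n + 1)) (Y n) + dist (Y n) (Y m)"
    using dist_triangle[of "Y (Suc n)" "Y m" "Y n"] by simp
  also have "\<dots> \<le> (LBINT u:{real n * h..real (n + 1) * h}. G u) + (LBINT u:{real m * h..real n * h}. G u)"
    using step Y[of n] by (intro add_mono) auto
  also have "\<dots> = (LBINT u:{real m * h..real (Suc n) * h}. G u)"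
    using set_integral_combine[OF L2_density_set_integrable(1)[OF G], of "real m * h" "real n * h" "real (n + 1) * h"] step h
    by simp
  finally show ?case .
qed

lemma sum_integral_cells:
  fixes f :: "real \<Rightarrow> real"
  assumes h: "0 < h" and f: "\<And>a b. set_integrable lborel {a..b} f"
  shows "(\<Sum>n<N. (LBINT u:{real n * h..real (n + 1) * h}. f u)) = (LBINT u:{0..real N * h}. f u)"
proof (induction N)
  case 0
  have "(LBINT u:{0..0}. f u) = integral {0..0} f"
    by (rule set_borel_integral_eq_integral(2)[OF f])
  then show ?case by simp
next
  case (Suc N)
  then show ?case using h set_integral_combine[OF f, of 0 "real N * h" "real (N + 1) * h"] by simp
qed

lemma L2_density_LBINT_mono:
  assumes G: "L2_density T G" and ab: "a' \<le> a" "b \<le> b'"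
  shows "(LBINT u:{a..b}. (G u)\<^sup>2) \<le> (LBINT u:{a'..b'}. (G u)\<^sup>2)"
  unfolding set_lebesgue_integral_def
  using L2_density_set_integrable(2)[OF G] ab unfolding set_integrable_def
  by (intro integral_mono) (auto simp: indicator_def)

text \<open>Cauchy-Schwarz on a cell gains its length \<open>h\<close>, which cancels the prefactor
  \<open>1 / h\<close>.\<close>

lemma energy_le:
  fixes Y :: "nat \<Rightarrow> 'a::real_normed_vector"
  assumes h: "0 < h" and G: "L2_density T G"
    and Y: "\<And>n. n < N \<Longrightarrow> dist (Y (n + 1)) (Y n) \<le> (LBINT u:{real n * h..real (n + 1) * h}. G u)"
  shows "(1 / h) * (\<Sum>n<N. (norm (Y (n + 1) - Y n))\<^sup>2) \<le> (LBINT u:{0..real N * h}. (G u)\<^sup>2)"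
proof -
  have "(1 / h) * (\<Sum>n<N. (norm (Y (n + 1) - Y n))\<^sup>2) = (\<Sum>n<N. (1 / h) * (dist (Y (n + 1)) (Y n))\<^sup>2)"
    by (simp add: sum_distrib_left dist_norm)
  also have "\<dots> \<le> (\<Sum>n<N. (LBINT u:{real n * h..real (n + 1) * h}. (G u)\<^sup>2))"
  proof (rule sum_mono)
    fix n assume "n \<in> {..<N}"
    then have "(dist (Y (n + 1)) (Y n))\<^sup>2 \<le> (LBINT u:{real n * h..real (n + 1) * h}. G u)\<^sup>2"
      using Y by (intro power_mono) auto
    also have "\<dots> \<le> (real (n + 1) * h - real n * h) * (LBINT u:{real n * h..real (n + 1) * h}. (G u)\<^sup>2)"
      using h by (intro L2_density_Cauchy_Schwarz[OF G]) simp
    also have "real (n + 1) * h - real n * h = h" by (simp add: algebra_simps)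
    finally show "(1 / h) * (dist (Y (n + 1)) (Y n))\<^sup>2 \<le> (LBINT u:{real n * h..real (n + 1) * h}. (G u)\<^sup>2)"
      using h by (simp add: divide_le_eq mult.commute)
  qed
  also have "\<dots> = (LBINT u:{0..real N * h}. (G u)\<^sup>2)"
    by (rule sum_integral_cells[OF h L2_density_set_integrable(2)[OF G]])
  finally show ?thesis .
qed

lemma interpolants_compact:
  fixes X :: "nat \<Rightarrow> nat \<Rightarrow> 'a::euclidean_space"
  assumes G: "L2_density T G"
    and h: "\<And>k. 0 < h k" "h \<longlonglongrightarrow> 0" and N: "\<And>k. real (N k) * h k = T"
    and X: "\<And>k n. n < N k \<Longrightarrow> dist (X k (n + 1)) (X k n) \<le> (LBINT u:{real n * h k..real (n + 1) * h k}. G u)"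
    and M: "\<And>k. norm (X k 0) \<le> M"
  obtains \<sigma> Y where "strict_mono \<sigma>" "continuous_on {0..T} Y" "H1_on T Y"
    "uniform_limit {0..T} (\<lambda>k. interpolant (h (\<sigma> k)) (X (\<sigma> k))) Y sequentially"
proof -
  define E where "E = (LBINT u:{0..T}. (G u)\<^sup>2)"
  \<comment> \<open>The L2 norm of \<open>G\<close> on \<open>{0..T}\<close>, which Cauchy-Schwarz
    turns into the Hoelder constant of the node values.\<close>
  define A where "A = sqrt E"
  have T: "0 \<le> T" using N[of 0] h(1)[of 0] by (metis less_imp_le mult_nonneg_nonneg of_nat_0_le_iff)
  have E0: "0 \<le> E" unfolding E_def set_lebesgue_integral_def by (intro Bochner_Integration.integral_nonneg) simp
  have A0: "0 \<le> A" by (simp add: A_def E0)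
  have G1: "(LBINT u:{s..t}. G u) \<le> A * sqrt (t - s)" if st: "0 \<le> s" "s \<le> t" "t \<le> T" for s t
  proof -
    have "(LBINT u:{s..t}. G u)\<^sup>2 \<le> (t - s) * (LBINT u:{s..t}. (G u)\<^sup>2)"
      using st by (intro L2_density_Cauchy_Schwarz[OF G])
    also have "\<dots> \<le> (t - s) * E"
      unfolding E_def using st by (intro mult_left_mono L2_density_LBINT_mono[OF G]) auto
    finally have "sqrt ((LBINT u:{s..t}. G u)\<^sup>2) \<le> sqrt ((t - s) * E)" by (rule real_sqrt_le_mono)
    then show ?thesis by (simp add: A_def real_sqrt_mult mult.commute)
  qed
  have hol: "dist (interpolant (h k) (X k) t) (interpolant (h k) (X k) s) \<le> 3 * A * sqrt (t - s)"
    if st: "0 \<le> s" "s \<le> t" "t \<le> T" for k s t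
  proof (rule dist_interpolant_le[OF h(1) A0])
    fix m n assume mn: "m \<le> n" "n \<le> N k"
    have "real n * h k \<le> real (N k) * h k" using mn h(1)[of k] by (intro mult_right_mono) auto
    then have nT: "real n * h k \<le> T" by (simp add: N)
    have "dist (X k n) (X k m) \<le> (LBINT u:{real m * h k..real n * h k}. G u)"
      by (rule dist_sequence_le_integral[OF h(1) G X mn])
    also have "\<dots> \<le> A * sqrt (real n * h k - real m * h k)"
      using mn h(1)[of k] nT by (intro G1) auto
    finally show "dist (X k n) (X k m) \<le> A * sqrt ((real n - real m) * h k)" by (simp add: left_diff_distrib)
  qed (use st N in auto)
  have hol': "dist (interpolant (h k) (X k) t) (interpolant (h k) (X k) s) \<le> 3 * A * sqrt \<bar>t - s\<bar>"
    if "s \<in> {0..T}" "t \<in> {0..T}" for k s t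
    using hol[of s t k] hol[of t s k] that by (cases "s \<le> t") (auto simp: dist_commute abs_if)
  have node0: "interpolant (h k) (X k) 0 = X k 0" for k
    using interpolant_node[OF h(1), of k "X k" 0] by simp
  have bound: "norm (interpolant (h k) (X k) t) \<le> M + 3 * A * sqrt T" if t: "t \<in> {0..T}" for k t
  proof -
    have "dist (interpolant (h k) (X k) t) (X k 0) \<le> 3 * A * sqrt (t - 0)"
      using hol[of 0 t k] t by (simp add: node0)
    also have "\<dots> \<le> 3 * A * sqrt T" using t A0 by (intro mult_left_mono) auto
    finally have "norm (interpolant (h k) (X k) t - X k 0) \<le> 3 * A * sqrt T" by (simp add: dist_norm)
    then show ?thesis using norm_triangle_sub[of "interpolant (h k) (X k) t" "X k 0"] M[of k] by linarith
  qed
  have equi: "\<exists>d>0. \<forall>k s. s \<in> {0..T} \<and> norm (t - s) < d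
      \<longrightarrow> norm (interpolant (h k) (X k) t - interpolant (h k) (X k) s) < e"
    if t: "t \<in> {0..T}" and e: "0 < e" for t e
  proof (intro exI conjI allI impI)
    \<comment> \<open>The summand 1 keeps the denominator positive when
      \<open>A = 0\<close>.\<close>
    define d where "d = (e / (3 * A + 1))\<^sup>2"
    show "0 < d" using e A0 by (simp add: d_def)
    fix k s assume s: "s \<in> {0..T} \<and> norm (t - s) < d"
    have "sqrt \<bar>t - s\<bar> < sqrt d" using s by simp
    also have "sqrt d = e / (3 * A + 1)" using e A0 by (simp add: d_def)
    finally have lt: "sqrt \<bar>t - s\<bar> < e / (3 * A + 1)" .
    have "dist (interpolant (h k) (X k) t) (interpolant (h k) (X k) s) \<le> 3 * A * sqrt \<bar>t - s\<bar>"
      using hol' s t by simp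
    also have "\<dots> \<le> (3 * A + 1) * sqrt \<bar>t - s\<bar>" by (intro mult_right_mono) auto
    also have "\<dots> < (3 * A + 1) * (e / (3 * A + 1))" using lt A0 by (intro mult_strict_left_mono) auto
    also have "\<dots> = e" using A0 by simp
    finally show "norm (interpolant (h k) (X k) t - interpolant (h k) (X k) s) < e" by (simp add: dist_norm)
  qed
  obtain Y \<sigma> where Y: "continuous_on {0..T} Y" and \<sigma>: "strict_mono (\<sigma> :: nat \<Rightarrow> nat)"
      and conv: "\<And>e. 0 < e \<Longrightarrow> \<exists>n. \<forall>k t. k \<ge> n \<and> t \<in> {0..T} \<longrightarrow> norm (interpolant (h (\<sigma> k)) (X (\<sigma> k)) t - Y t) < e"
    using Arzela_Ascoli[of "{0..T}" "\<lambda>k. interpolant (h k) (X k)" "M + 3 * A * sqrt T", OF compact_Icc bound equi]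
    by blast
  have ul: "uniform_limit {0..T} (\<lambda>k. interpolant (h (\<sigma> k)) (X (\<sigma> k))) Y sequentially"
    unfolding uniform_limit_sequentially_iff dist_norm using conv by blast
  have h\<sigma>: "(\<lambda>k. h (\<sigma> k)) \<longlonglongrightarrow> 0"
    using LIMSEQ_subseq_LIMSEQ[OF h(2) \<sigma>] by (simp add: o_def)
  define \<Gamma> where "\<Gamma> t = (LBINT u:{0..t}. G u)" for t
  have \<Gamma>diff: "(LBINT u:{s..t}. G u) = \<Gamma> t - \<Gamma> s" if "0 \<le> s" "s \<le> t" for s t
    using set_integral_combine[OF L2_density_set_integrable(1)[OF G] that] by (simp add: \<Gamma>_def)
  have \<Gamma>c: "continuous_on {0..T} \<Gamma>"
    unfolding \<Gamma>_def by (rule continuous_on_L2_density_primitive[OF G])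
  have "dist (Y t) (Y s) \<le> (LBINT u:{s..t}. G u)" if st: "0 \<le> s" "s \<le> t" "t \<le> T" for s t
  proof -
    \<comment> \<open>Domination by \<open>G\<close> without an extra factor is known only between
      nodes. So \<open>s\<close> and \<open>t\<close> are replaced by the nodes just below them, and
      both sides pass to the limit.\<close>
    define \<tau> where "\<tau> t k = real (nat \<lfloor>t / h (\<sigma> k)\<rfloor>) * h (\<sigma> k)" for t k
    have \<tau>: "\<tau> t k \<le> t" "t - h (\<sigma> k) \<le> \<tau> t k" "\<tau> t k \<in> {0..T}" if "t \<in> {0..T}" for t k
      using nat_floor_mult_bounds[OF h(1), of t "\<sigma> k"] that h(1)[of "\<sigma> k"] by (auto simp: \<tau>_def algebra_simps)
    have \<tau>lim: "\<tau> t \<longlonglongrightarrow> t" if t: "t \<in> {0..T}" for t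
    proof (rule tendsto_sandwich)
      show "(\<lambda>k. t - h (\<sigma> k)) \<longlonglongrightarrow> t" using tendsto_diff[OF tendsto_const h\<sigma>, of t] by simp
    qed (use \<tau>[OF t] in auto)
    have lim: "(\<lambda>k. interpolant (h (\<sigma> k)) (X (\<sigma> k)) (\<tau> t k)) \<longlonglongrightarrow> Y t" if t: "t \<in> {0..T}" for t
      by (rule uniform_limit_tendsto_compose[OF ul Y \<tau>lim[OF t] t]) (use \<tau>(3)[OF t] in auto)
    have \<Gamma>lim: "(\<lambda>k. \<Gamma> (\<tau> t k)) \<longlonglongrightarrow> \<Gamma> t" if t: "t \<in> {0..T}" for t
      by (rule continuous_on_tendsto_compose[OF \<Gamma>c \<tau>lim[OF t] t]) (use \<tau>(3)[OF t] in auto)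
    have s: "s \<in> {0..T}" and t: "t \<in> {0..T}" using st by auto
    have "dist (Y t) (Y s) \<le> \<Gamma> t - \<Gamma> s"
    proof (rule LIMSEQ_le[OF tendsto_dist[OF lim[OF t] lim[OF s]] tendsto_diff[OF \<Gamma>lim[OF t] \<Gamma>lim[OF s]]])
      show "\<exists>K. \<forall>k\<ge>K. dist (interpolant (h (\<sigma> k)) (X (\<sigma> k)) (\<tau> t k)) (interpolant (h (\<sigma> k)) (X (\<sigma> k)) (\<tau> s k))
          \<le> \<Gamma> (\<tau> t k) - \<Gamma> (\<tau> s k)"
      proof (intro exI allI impI)
        fix k
        have le: "nat \<lfloor>s / h (\<sigma> k)\<rfloor> \<le> nat \<lfloor>t / h (\<sigma> k)\<rfloor>"
          using st h(1)[of "\<sigma> k"] by (intro nat_mono floor_mono divide_right_mono) auto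
        have "real (nat \<lfloor>t / h (\<sigma> k)\<rfloor>) * h (\<sigma> k) \<le> real (N (\<sigma> k)) * h (\<sigma> k)"
          using \<tau>[OF t, of k] by (simp add: N \<tau>_def)
        then have le2: "nat \<lfloor>t / h (\<sigma> k)\<rfloor> \<le> N (\<sigma> k)" using h(1)[of "\<sigma> k"] by simp
        have \<tau>le: "0 \<le> \<tau> s k" "\<tau> s k \<le> \<tau> t k"
          using le h(1)[of "\<sigma> k"] by (auto simp: \<tau>_def intro: mult_right_mono)
        have "dist (X (\<sigma> k) (nat \<lfloor>t / h (\<sigma> k)\<rfloor>)) (X (\<sigma> k) (nat \<lfloor>s / h (\<sigma> k)\<rfloor>)) \<le> (LBINT u:{\<tau> s k..\<tau> t k}. G u)"
          unfolding \<tau>_def by (rule dist_sequence_le_integral[OF h(1) G X le le2])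
        also have "\<dots> = \<Gamma> (\<tau> t k) - \<Gamma> (\<tau> s k)" by (rule \<Gamma>diff[OF \<tau>le])
        finally show "dist (interpolant (h (\<sigma> k)) (X (\<sigma> k)) (\<tau> t k)) (interpolant (h (\<sigma> k)) (X (\<sigma> k)) (\<tau> s k))
          \<le> \<Gamma> (\<tau> t k) - \<Gamma> (\<tau> s k)"
          unfolding \<tau>_def by (simp only: interpolant_node[OF h(1)])
      qed
    qed
    then show ?thesis using \<Gamma>diff st by simp
  qed
  then have "H1_on T Y" by (rule H1_on_if_dominated[OF T G])
  then show thesis using that \<sigma> Y ul by blast
qed

section \<open>The limit equation\<close>

text \<open>Dominated convergence: up to null sets, the memory at step \<open>n\<close> is the integral of
  \<open>\<rho> a *\<^sub>R U (n - nat \<lfloor>a / h\<rfloor>)\<close> over the lags \<open>h \<le> a < (n + 1) h\<close>.\<close>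

lemma discrete_convolution_tendsto:
  fixes U :: "nat \<Rightarrow> nat \<Rightarrow> 'a::euclidean_space" and Z :: "real \<Rightarrow> 'a" and h :: "nat \<Rightarrow> real"
  assumes h: "\<And>k. 0 < h k" "h \<longlonglongrightarrow> 0" and t: "0 < t"
    and \<rho>: "continuous_on {0..} \<rho>" "set_integrable lborel {0..} \<rho>"
    and U: "\<And>k i. i \<le> nat \<lfloor>t / h k\<rfloor> \<Longrightarrow> norm (U k i) \<le> B"
    and Z: "continuous_on {0..t} Z"
    and lim: "\<And>a. 0 < a \<Longrightarrow> a < t \<Longrightarrow> (\<lambda>k. U k (nat \<lfloor>t / h k\<rfloor> - nat \<lfloor>a / h k\<rfloor>)) \<longlonglongrightarrow> Z (t - a)"
  shows "(\<lambda>k. \<Sum>j<nat \<lfloor>t / h k\<rfloor>. (h k * weight \<rho> (h k) (j + 1)) *\<^sub>R U k (nat \<lfloor>t / h k\<rfloor> - (j + 1)))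
    \<longlonglongrightarrow> (LBINT a:{0..t}. \<rho> a *\<^sub>R Z (t - a))"
proof -
  define n where "n k = nat \<lfloor>t / h k\<rfloor>" for k
  \<comment> \<open>Cell \<open>j\<close> belongs to lag index \<open>j + 1\<close>: lags below
    \<open>h k\<close> do not occur in the functional.\<close>
  define I where "I k j = {real (j + 1) * h k..real (j + 1 + 1) * h k}" for k j
  define s where "s k a = (\<Sum>j<n k. (indicator (I k j) a *\<^sub>R \<rho> a) *\<^sub>R U k (n k - (j + 1)))" for k a
  define f where "f a = indicator {0..t} a *\<^sub>R (\<rho> a *\<^sub>R Z (t - a))" for a
  define w where "w a = indicator {0..} a *\<^sub>R (\<bar>\<rho> a\<bar> * B)" for a
  have B: "0 \<le> B" using U[of 0 0] norm_ge_zero[of "U 0 0"] by linarith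
  have I0: "I k j \<subseteq> {0..}" for k j
    unfolding I_def using h(1)[of k] by (auto intro: order_trans[OF mult_nonneg_nonneg])
  have \<rho>I: "set_integrable lborel (I k j) \<rho>" for k j
    by (rule set_integrable_subset[OF \<rho>(2) _ I0]) (simp add: I_def)
  have int_s: "integral\<^sup>L lborel (s k) = (\<Sum>j<n k. (h k * weight \<rho> (h k) (j + 1)) *\<^sub>R U k (n k - (j + 1)))" for k
  proof -
    have "integral\<^sup>L lborel (s k) = (\<Sum>j<n k. (LBINT a:I k j. \<rho> a) *\<^sub>R U k (n k - (j + 1)))"
      unfolding s_def set_lebesgue_integral_def using \<rho>I
      by (subst Bochner_Integration.integral_sum) (auto simp: set_integrable_def)
    moreover have "(LBINT a:I k j. \<rho> a) = h k * weight \<rho> (h k) (j + 1)" for j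
      using h(1)[of k] by (simp add: weight_def I_def)
    ultimately show ?thesis by simp
  qed
  \<comment> \<open>A lag off the grid lies in at most one cell, so the sum collapses to a single
    term.\<close>
  have s_eq: "s k a = (if 0 < a \<and> 1 \<le> nat \<lfloor>a / h k\<rfloor> \<and> nat \<lfloor>a / h k\<rfloor> \<le> n k
      then \<rho> a *\<^sub>R U k (n k - nat \<lfloor>a / h k\<rfloor>) else 0)" if a: "\<And>i. a \<noteq> real i * h k" for k a
  proof (cases "0 < a")
    case True
    define i where "i = nat \<lfloor>a / h k\<rfloor>"
    have i: "real i * h k \<le> a" "a < (real i + 1) * h k"
      unfolding i_def by (rule nat_floor_mult_bounds; use True h(1) in auto)+
    have ind: "indicator (I k j) a = (if j + 1 = i then 1 else 0 :: real)" for j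
    proof -
      have "a \<in> I k j \<longleftrightarrow> real (j + 1) * h k \<le> a \<and> a < (real (j + 1) + 1) * h k"
        unfolding I_def using a[of "j + 1"] a[of "j + 1 + 1"] by (force simp: algebra_simps less_le)
      also have "\<dots> \<longleftrightarrow> j + 1 = i"
      proof
        assume "real (j + 1) * h k \<le> a \<and> a < (real (j + 1) + 1) * h k"
        then show "j + 1 = i" unfolding i_def by (intro nat_floor_divide_eq[symmetric] h(1)) auto
      next
        assume "j + 1 = i"
        then show "real (j + 1) * h k \<le> a \<and> a < (real (j + 1) + 1) * h k" using i by simp
      qed
      finally show ?thesis by (simp add: indicator_def)
    qed
    have "s k a = (\<Sum>j<n k. if j + 1 = i then \<rho> a *\<^sub>R U k (n k - i) else 0)"
      unfolding s_def ind by (intro sum.cong) auto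
    also have "\<dots> = (if 1 \<le> i \<and> i \<le> n k then \<rho> a *\<^sub>R U k (n k - i) else 0)"
      by (cases i) (auto simp: Suc_le_eq)
    finally show ?thesis using True by (simp add: i_def)
  next
    case False
    then have "a < 0" using a[of 0] by simp
    then have "indicator (I k j) a = (0::real)" for j using I0[of k j] by (auto simp: indicator_def)
    then show ?thesis using False by (simp add: s_def)
  qed
  \<comment> \<open>Countably many lags are removed: the grid points (among them 0), which may lie
    in two closed cells, and \<open>t\<close>, where no convergence is assumed.\<close>
  have AE: "AE a in lborel. a \<notin> insert t (\<Union>k. \<Union>i. {real i * h k})"
    by (rule AE_not_in) (intro countable_imp_null_set_lborel countable_insert countable_UN; simp)
  have "(\<lambda>k. integral\<^sup>L lborel (s k)) \<longlonglongrightarrow> integral\<^sup>L lborel f"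
  proof (rule integral_dominated_convergence)
    have "continuous_on {0..t} (\<lambda>a. \<rho> a *\<^sub>R Z (t - a))"
      by (intro continuous_on_scaleR continuous_on_subset[OF \<rho>(1)] continuous_on_compose2[OF Z])
         (auto intro!: continuous_intros)
    then show "f \<in> borel_measurable lborel"
      unfolding f_def by (auto dest: borel_measurable_continuous_on_indicator[rotated])
    show "s k \<in> borel_measurable lborel" for k
      unfolding s_def
      by (intro borel_measurable_sum borel_measurable_scaleR[OF borel_measurable_integrable borel_measurable_const]
            \<rho>I[unfolded set_integrable_def])
    show "integrable lborel w"
      using \<rho>(2) unfolding w_def set_integrable_def[symmetric]
      by (auto intro: set_integrable_abs)
    show "AE a in lborel. norm (s k a) \<le> w a" for k
      using AE
    proof eventually_elim
      case (elim a)
      then have "s k a = (if 0 < a \<and> 1 \<le> nat \<lfloor>a / h k\<rfloor> \<and> nat \<lfloor>a / h k\<rfloor> \<le> n k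
        then \<rho> a *\<^sub>R U k (n k - nat \<lfloor>a / h k\<rfloor>) else 0)" by (intro s_eq) auto
      moreover have "norm (U k (n k - nat \<lfloor>a / h k\<rfloor>)) \<le> B" by (rule U) (simp add: n_def)
      ultimately show ?case using B by (auto simp: w_def intro: mult_left_mono)
    qed
    show "AE a in lborel. (\<lambda>k. s k a) \<longlonglongrightarrow> f a"
      using AE
    proof eventually_elim
      case (elim a)
      then have s: "s k a = (if 0 < a \<and> 1 \<le> nat \<lfloor>a / h k\<rfloor> \<and> nat \<lfloor>a / h k\<rfloor> \<le> n k
        then \<rho> a *\<^sub>R U k (n k - nat \<lfloor>a / h k\<rfloor>) else 0)" for k by (intro s_eq) auto
      have "a \<noteq> t" using elim by auto
      moreover have "a \<noteq> 0" using elim UN_I[of 0 UNIV 0] by auto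
      ultimately consider "a < 0" | "0 < a" "a < t" | "t < a" by linarith
      then show ?case
      proof cases
        case 1
        then show ?thesis by (simp add: s f_def)
      next
        case 2
        \<comment> \<open>Once \<open>h k < a\<close> the lag has left the omitted first cell, so
          its term is present.\<close>
        have "\<forall>\<^sub>F k in sequentially. h k < a" using order_tendstoD(2)[OF h(2)] 2 by simp
        then have "\<forall>\<^sub>F k in sequentially. \<rho> a *\<^sub>R U k (n k - nat \<lfloor>a / h k\<rfloor>) = s k a"
        proof eventually_elim
          case (elim k)
          have "1 \<le> a / h k" using elim h(1)[of k] by simp
          then have "1 \<le> nat \<lfloor>a / h k\<rfloor>" by linarith
          moreover have "nat \<lfloor>a / h k\<rfloor> \<le> n k"
            unfolding n_def using 2 h(1)[of k] by (intro nat_mono floor_mono divide_right_mono) auto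
          ultimately show ?case using 2 by (simp add: s)
        qed
        moreover have "(\<lambda>k. \<rho> a *\<^sub>R U k (n k - nat \<lfloor>a / h k\<rfloor>)) \<longlonglongrightarrow> \<rho> a *\<^sub>R Z (t - a)"
          unfolding n_def using lim 2 by (intro tendsto_intros) auto
        ultimately have "(\<lambda>k. s k a) \<longlonglongrightarrow> \<rho> a *\<^sub>R Z (t - a)"
          by (rule Lim_transform_eventually[rotated])
        then show ?thesis using 2 by (simp add: f_def)
      next
        case 3
        \<comment> \<open>Once \<open>h k < a - t\<close> the cell index of \<open>a\<close> exceeds
          \<open>n k\<close> and no term is left.\<close>
        have "\<forall>\<^sub>F k in sequentially. h k < a - t" using order_tendstoD(2)[OF h(2)] 3 by simp
        then have "\<forall>\<^sub>F k in sequentially. s k a = 0"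
        proof eventually_elim
          case (elim k)
          have "t / h k + 1 = (t + h k) / h k" using h(1)[of k] by (simp add: field_simps)
          also have "\<dots> \<le> a / h k" using elim h(1)[of k] by (intro divide_right_mono) auto
          finally have "t / h k + 1 \<le> a / h k" .
          moreover have "0 \<le> t / h k" using t h(1)[of k] by simp
          ultimately have "n k < nat \<lfloor>a / h k\<rfloor>" unfolding n_def by linarith
          then show ?case by (simp add: s)
        qed
        then have "(\<lambda>k. s k a) \<longlonglongrightarrow> 0" by (rule tendsto_eventually)
        then show ?thesis using 3 by (simp add: f_def)
      qed
    qed
  qed
  then show ?thesis unfolding int_s unfolding n_def f_def[abs_def] set_lebesgue_integral_def .
qed

lemma weight_nonneg:
  assumes "0 < h" "\<And>a. 0 \<le> a \<Longrightarrow> 0 \<le> \<rho> a"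
  shows "0 \<le> weight \<rho> h j"
proof -
  have "0 \<le> (LBINT a:{real j * h..real (j + 1) * h}. \<rho> a)"
    unfolding set_lebesgue_integral_def
  proof (rule Bochner_Integration.integral_nonneg)
    fix a
    have "0 \<le> real j * h" using assms(1) by simp
    then show "0 \<le> indicat_real {real j * h..real (j + 1) * h} a *\<^sub>R \<rho> a"
      using assms(2)[of a] by (auto simp: indicator_def)
  qed
  then show ?thesis using assms(1) by (simp add: weight_def)
qed

lemma weight_0_le:
  assumes h: "0 < h" and i: "set_integrable lborel {0..} \<rho>" and m: "\<And>a. 0 \<le> a \<Longrightarrow> a \<le> h \<Longrightarrow> \<rho> a \<le> m"
  shows "weight \<rho> h 0 \<le> m"
proof -
  have si: "set_integrable lborel {0..h} \<rho>" by (rule set_integrable_subset[OF i]) auto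
  have "integral {0..h} \<rho> \<le> integral {0..h} (\<lambda>_. m)"
    by (rule integral_le[OF set_borel_integral_eq_integral(1)[OF si]]) (use m in auto)
  then have "(LBINT a:{0..h}. \<rho> a) \<le> h * m"
    using h by (simp add: set_borel_integral_eq_integral(2)[OF si])
  then show ?thesis using h by (simp add: weight_def divide_le_eq mult.commute)
qed

text \<open>The continuous counterpart of subtracting the past in \<open>memory\<close>: unit mass
  reproduces \<open>x\<close>, and the remainder vanishes for \<open>a > t\<close>, where
  \<open>Y (t - a) = x\<close>.\<close>

lemma memory_integral_eq:
  fixes Y :: "real \<Rightarrow> 'a::euclidean_space"
  assumes \<rho>: "continuous_on {0..} \<rho>" "set_integrable lborel {0..} \<rho>" "(LBINT a:{0..}. \<rho> a) = 1"
    and Y: "continuous_on {0..t} Y" "\<And>s. s < 0 \<Longrightarrow> Y s = x"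
  shows "(LBINT a:{0..}. \<rho> a *\<^sub>R Y (t - a)) = x + (LBINT a:{0..t}. \<rho> a *\<^sub>R (Y (t - a) - x))"
proof -
  have eq: "indicat_real {0..} a *\<^sub>R (\<rho> a *\<^sub>R Y (t - a))
      = (indicat_real {0..} a *\<^sub>R \<rho> a) *\<^sub>R x + indicat_real {0..t} a *\<^sub>R (\<rho> a *\<^sub>R (Y (t - a) - x))" for a
    using Y(2)[of "t - a"] by (auto simp: indicator_def scaleR_diff_right)
  have "set_integrable lborel {0..t} (\<lambda>a. \<rho> a *\<^sub>R (Y (t - a) - x))"
    by (intro borel_integrable_atLeastAtMost' continuous_on_scaleR continuous_on_subset[OF \<rho>(1)]
          continuous_on_diff continuous_on_const continuous_on_compose2[OF Y(1)])
       (auto intro!: continuous_intros)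
  moreover have "integrable lborel (\<lambda>a. (indicat_real {0..} a *\<^sub>R \<rho> a) *\<^sub>R x)"
    using \<rho>(2) unfolding set_integrable_def by (intro integrable_scaleR_left)
  ultimately show ?thesis
    using \<rho>(2,3) unfolding set_lebesgue_integral_def set_integrable_def eq by simp
qed

text \<open>At the node just below \<open>t\<close> the iterate is a projection whose centre and
  argument both converge, and the projection is continuous jointly in the two. The equation thus
  holds at every interior \<open>t\<close>.\<close>

lemma scheme_limit_equation:
  fixes Y :: "real \<Rightarrow> 'a::euclidean_space" and h :: "nat \<Rightarrow> real" and c :: "real \<Rightarrow> 'a" and x :: 'a
  assumes \<rho>: "continuous_on {0..} \<rho>" "set_integrable lborel {0..} \<rho>" "\<And>a. 0 \<le> a \<Longrightarrow> 0 \<le> \<rho> a"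
    and r: "0 \<le> r"
    and h: "\<And>k. 0 < h k" "h \<longlonglongrightarrow> 0"
    and w: "\<And>k. (\<lambda>j. h k * weight \<rho> (h k) j) sums 1" "\<And>k. weight \<rho> (h k) 0 \<le> m"
    and c: "continuous_on {0..T} c"
  defines "X \<equiv> \<lambda>k. scheme \<rho> (\<lambda>t. cball (c t) r) x (h k)"
  assumes B: "\<And>k i. real i * h k \<le> T \<Longrightarrow> norm (X k i - x) \<le> B"
    and Y: "continuous_on {0..T} Y" "uniform_limit {0..T} (\<lambda>k. interpolant (h k) (X k)) Y sequentially"
    and t: "0 < t" "t < T"
  shows "Y t = closest_point (cball (c t) r) (x + (LBINT a:{0..t}. \<rho> a *\<^sub>R (Y (t - a) - x)))"
proof -
  define n where "n k = nat \<lfloor>t / h k\<rfloor>" for k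
  define I where "I = (LBINT a:{0..t}. \<rho> a *\<^sub>R (Y (t - a) - x))"
  have n: "real (n k) * h k \<le> t" "t < (real (n k) + 1) * h k" for k
    unfolding n_def by (rule nat_floor_mult_bounds; use h(1) t in simp)+
  have node: "(\<lambda>k. X k (q k)) \<longlonglongrightarrow> Y s"
    if q: "(\<lambda>k. real (q k) * h k) \<longlonglongrightarrow> s" "\<And>k. real (q k) * h k \<le> T" "0 \<le> s" "s \<le> T" for q s
  proof -
    have "(\<lambda>k. interpolant (h k) (X k) (real (q k) * h k)) \<longlonglongrightarrow> Y s"
      using q h(1) by (intro uniform_limit_tendsto_compose[OF Y(2,1)]) (auto simp: less_imp_le)
    then show ?thesis by (simp add: interpolant_node[OF h(1)])
  qed
  have floor_lim: "(\<lambda>k. real (nat \<lfloor>a / h k\<rfloor>) * h k) \<longlonglongrightarrow> a" if a: "0 \<le> a" for a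
  proof (rule tendsto_sandwich)
    show "(\<lambda>k. a - h k) \<longlonglongrightarrow> a" using tendsto_diff[OF tendsto_const h(2), of a] by simp
    show "\<forall>\<^sub>F k in sequentially. a - h k \<le> real (nat \<lfloor>a / h k\<rfloor>) * h k"
      using nat_floor_mult_bounds(2)[OF h(1) a] by (intro always_eventually allI) (simp add: algebra_simps less_imp_le)
    show "\<forall>\<^sub>F k in sequentially. real (nat \<lfloor>a / h k\<rfloor>) * h k \<le> a"
      using nat_floor_mult_bounds(1)[OF h(1) a] by (intro always_eventually allI)
  qed simp
  have XY: "(\<lambda>k. X k (n k)) \<longlonglongrightarrow> Y t"
    using n(1) t floor_lim[of t] by (intro node) (auto simp: n_def intro: order_trans less_imp_le)
  have "(\<lambda>k. \<Sum>j<nat \<lfloor>t / h k\<rfloor>. (h k * weight \<rho> (h k) (j + 1)) *\<^sub>R (X k (nat \<lfloor>t / h k\<rfloor> - (j + 1)) - x)) \<longlonglongrightarrow> I"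
    unfolding I_def
  proof (rule discrete_convolution_tendsto[OF h t(1) \<rho>(1,2), where U = "\<lambda>k i. X k i - x" and B = B and Z = "\<lambda>s. Y s - x"])
    show "norm (X k i - x) \<le> B" if "i \<le> nat \<lfloor>t / h k\<rfloor>" for k i
    proof (rule B)
      have "real i * h k \<le> real (n k) * h k" using that h(1)[of k] by (intro mult_right_mono) (auto simp: n_def)
      then show "real i * h k \<le> T" using n(1)[of k] t by linarith
    qed
    show "continuous_on {0..t} (\<lambda>s. Y s - x)"
      using t by (intro continuous_on_diff continuous_on_const continuous_on_subset[OF Y(1)]) auto
    fix a assume a: "0 < a" "a < t"
    have le: "nat \<lfloor>a / h k\<rfloor> \<le> n k" for k
      using a h(1)[of k] unfolding n_def by (intro nat_mono floor_mono divide_right_mono) auto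
    have eq: "real (n k - nat \<lfloor>a / h k\<rfloor>) * h k = real (n k) * h k - real (nat \<lfloor>a / h k\<rfloor>) * h k" for k
      using le[of k] by (simp add: left_diff_distrib of_nat_diff)
    have "(\<lambda>k. X k (n k - nat \<lfloor>a / h k\<rfloor>)) \<longlonglongrightarrow> Y (t - a)"
    proof (rule node)
      show "(\<lambda>k. real (n k - nat \<lfloor>a / h k\<rfloor>) * h k) \<longlonglongrightarrow> t - a"
        unfolding eq using t a unfolding n_def by (intro tendsto_diff floor_lim) auto
      fix k
      have "0 \<le> real (nat \<lfloor>a / h k\<rfloor>) * h k" using h(1)[of k] by simp
      then show "real (n k - nat \<lfloor>a / h k\<rfloor>) * h k \<le> T" unfolding eq using n(1)[of k] t by linarith
    qed (use a t in auto)
    then show "(\<lambda>k. X k (nat \<lfloor>t / h k\<rfloor> - nat \<lfloor>a / h k\<rfloor>) - x) \<longlonglongrightarrow> Y (t - a) - x"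
      unfolding n_def by (intro tendsto_diff tendsto_const)
  qed
  then have conv: "(\<lambda>k. h k *\<^sub>R memory \<rho> (\<lambda>t. cball (c t) r) x (h k) (n k)) \<longlonglongrightarrow> I"
    by (simp add: memory_def n_def X_def scaleR_sum_right)
  \<comment> \<open>The uniform bound \<open>m\<close> on the first weight makes the normalisation
    tend to 1 and, eventually, positive, as the projection formula requires.\<close>
  have hw: "(\<lambda>k. h k * weight \<rho> (h k) 0) \<longlonglongrightarrow> 0"
  proof (rule tendsto_sandwich[OF _ _ tendsto_const])
    show "(\<lambda>k. h k * m) \<longlonglongrightarrow> 0" using tendsto_mult_left_zero[OF h(2)] .
    show "\<forall>\<^sub>F k in sequentially. 0 \<le> h k * weight \<rho> (h k) 0"
      using h(1) weight_nonneg[OF h(1) \<rho>(3)] by (intro always_eventually allI mult_nonneg_nonneg) (auto simp: less_imp_le)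
    show "\<forall>\<^sub>F k in sequentially. h k * weight \<rho> (h k) 0 \<le> h k * m"
      using w(2) h(1) by (intro always_eventually allI mult_left_mono) (auto simp: less_imp_le)
  qed
  have one: "(\<lambda>k. 1 - h k * weight \<rho> (h k) 0) \<longlonglongrightarrow> 1"
    using tendsto_diff[OF tendsto_const hw, of 1] by simp
  \<comment> \<open>The barycentre of the past, with \<open>1 / S\<close> rewritten as
    \<open>h / (1 - h R_0)\<close> so that the factor \<open>h\<close> turns the memory into a
    Riemann-type sum.\<close>
  define b where "b k = x + (1 / (1 - h k * weight \<rho> (h k) 0)) *\<^sub>R (h k *\<^sub>R memory \<rho> (\<lambda>t. cball (c t) r) x (h k) (n k))" for k
  have "b \<longlonglongrightarrow> x + (1 / 1) *\<^sub>R I"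
    unfolding b_def by (intro tendsto_intros one conv) simp
  then have blim: "b \<longlonglongrightarrow> x + I" by simp
  have clim: "(\<lambda>k. c (real (n k) * h k)) \<longlonglongrightarrow> c t"
  proof (rule continuous_on_tendsto_compose[OF c])
    show "(\<lambda>k. real (n k) * h k) \<longlonglongrightarrow> t" unfolding n_def using t by (intro floor_lim) simp
    show "\<forall>\<^sub>F k in sequentially. real (n k) * h k \<in> {0..T}"
      using order_trans[OF n(1) less_imp_le[OF t(2)]] h(1) by (intro always_eventually allI) (simp add: less_imp_le)
  qed (use t in auto)
  have "\<forall>\<^sub>F k in sequentially. 0 < 1 - h k * weight \<rho> (h k) 0"
    by (rule order_tendstoD(1)[OF one]) simp
  then have Xb: "\<forall>\<^sub>F k in sequentially. closest_point (cball (c (real (n k) * h k)) r) (b k) = X k (n k)"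
  proof eventually_elim
    case (elim k)
    note s1 = weight_tail_sums[OF h(1) w(1), of k]
    have S: "(\<Sum>j. weight \<rho> (h k) (j + 1)) = (1 - h k * weight \<rho> (h k) 0) / h k"
      by (rule sums_unique[OF s1, symmetric])
    have "0 < (\<Sum>j. weight \<rho> (h k) (j + 1))" unfolding S using elim h(1)[of k] by simp
    from scheme_eq_closest_point[OF h(1) sums_summable[OF s1] weight_nonneg[OF h(1) \<rho>(3)] _ _ _ this,
        of "\<lambda>t. cball (c t) r" "n k" x] r
    show ?case unfolding X_def b_def S by simp
  qed
  have "(\<lambda>k. closest_point (cball (c (real (n k) * h k)) r) (b k)) \<longlonglongrightarrow> closest_point (cball (c t) r) (x + I)"
  proof (rule metric_tendsto_imp_tendsto)
    have "(\<lambda>k. dist (b k) (x + I) + 2 * dist (c (real (n k) * h k)) (c t)) \<longlonglongrightarrow> dist (x + I) (x + I) + 2 * dist (c t) (c t)"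
      by (intro tendsto_intros blim clim)
    then show "(\<lambda>k. dist (b k) (x + I) + 2 * dist (c (real (n k) * h k)) (c t)) \<longlonglongrightarrow> 0" by simp
    show "\<forall>\<^sub>F k in sequentially. dist (closest_point (cball (c (real (n k) * h k)) r) (b k)) (closest_point (cball (c t) r) (x + I))
        \<le> dist (dist (b k) (x + I) + 2 * dist (c (real (n k) * h k)) (c t)) 0"
      using dist_closest_point_cball_le[OF r] by (intro always_eventually allI) simp
  qed
  then have "(\<lambda>k. X k (n k)) \<longlonglongrightarrow> closest_point (cball (c t) r) (x + I)"
    by (rule Lim_transform_eventually[OF _ Xb])
  then show ?thesis using LIMSEQ_unique[OF XY] by (simp add: I_def)
qed

theorem theorem6:
  fixes T r \<zeta> C\<^sub>R :: real and \<rho> :: "real \<Rightarrow> real"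
    and c :: "real \<Rightarrow> real ^ 'm" and x :: "real ^ 'm"
    and K :: "real \<Rightarrow> (real ^ 'm) set" and X :: "real \<Rightarrow> nat \<Rightarrow> real ^ 'm"
    and N :: "real \<Rightarrow> nat"
  defines "K \<equiv> \<lambda>t. cball (c t) r"
    and "X \<equiv> \<lambda>h. scheme \<rho> K x h"
    and "N \<equiv> \<lambda>h. nat \<lfloor>T / h\<rfloor>"
  assumes "T > 0" and "r \<ge> 0" and "H1_on T c"
    and "\<And>a. a \<ge> 0 \<Longrightarrow> \<rho> a \<ge> 0" and "\<exists>L. L-lipschitz_on {0..} \<rho>"
    and "(LBINT a:{0..}. \<rho> a) = 1"
    and "set_integrable lborel {0..} (\<lambda>a. (1 + a)\<^sup>2 * \<rho> a)"
    and "\<zeta> > 0"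
    and "AE a in lborel. a > 0 \<longrightarrow> \<rho> differentiable (at a)
           \<and> deriv \<rho> a \<le> 0 \<and> - deriv \<rho> a / \<rho> a \<le> \<zeta>"
    and "\<And>h. h \<in> steps T \<Longrightarrow> decseq (weight \<rho> h)"
    and "\<And>h. h \<in> steps T \<Longrightarrow> (\<lambda>j. h * weight \<rho> h j) sums 1"
    and "x \<in> K 0"
    and "\<And>h. h \<in> steps T \<Longrightarrow>
           summable (\<lambda>j. ((weight \<rho> h j - weight \<rho> h (j + 1)) / h)\<^sup>2 * (1 / weight \<rho> h (j + 1)))"
    and "\<And>h. h \<in> steps T \<Longrightarrow>
           h * (\<Sum>j. ((weight \<rho> h j - weight \<rho> h (j + 1)) / h)\<^sup>2 * (1 / weight \<rho> h (j + 1))) \<le> C\<^sub>R"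
  shows "(\<exists>C>0. \<forall>h\<in>steps T.
            (SUP n\<in>{0..N h}. norm (X h n)) \<le> C \<and>
            (1 / h) * (\<Sum>n<N h. (norm (X h (n + 1) - X h n))\<^sup>2) \<le> C)
       \<and> (\<forall>hs. (\<forall>k. hs k \<in> steps T) \<and> hs \<longlonglongrightarrow> 0 \<longrightarrow>
            (\<exists>\<sigma> :: nat \<Rightarrow> nat. \<exists>Y :: real \<Rightarrow> real ^ 'm. strict_mono \<sigma>
               \<and> H1_on T Y \<and> (\<forall>t<0. Y t = x)
               \<and> uniform_limit {0..T} (\<lambda>k. interpolant (hs (\<sigma> k)) (X (hs (\<sigma> k)))) Y sequentially
               \<and> (AE t in lborel. t \<in> {0<..<T} \<longrightarrow>
                    Y t = closest_point (K t) (LBINT s:{0..}. \<rho> s *\<^sub>R Y (t - s)))))"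
proof -
  note T = assms(4) and r = assms(5) and H1 = assms(6) and \<rho>0 = assms(7) and \<rho>1 = assms(9)
    and dec = assms(13) and w1 = assms(14)
  have steps: "0 < h" "h \<le> T" "real (N h) * h = T" if "h \<in> steps T" for h
  proof -
    show h: "0 < h" using that by (simp add: steps_def)
    have "T / h \<in> \<nat>" using that by (simp add: steps_def)
    then obtain k where k: "T / h = real k" by (rule Nats_cases)
    then have "N h = k" by (simp add: N_def)
    then show eq: "real (N h) * h = T" using k h by (simp add: field_simps)
    then have "N h \<noteq> 0" using T by (cases "N h = 0") auto
    then have "1 \<le> real (N h)" by simp
    then have "1 * h \<le> real (N h) * h" using h by (intro mult_right_mono) auto
    then show "h \<le> T" using eq by simp
  qed
  obtain L where L: "L-lipschitz_on {0..} \<rho>" using assms(8) by blast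
  have \<rho>c: "continuous_on {0..} \<rho>" by (rule lipschitz_on_continuous_on[OF L])
  \<comment> \<open>A non-integrable function has Bochner integral 0 by convention, so an integral
    equal to 1 forces integrability.\<close>
  have \<rho>i: "set_integrable lborel {0..} \<rho>"
    using \<rho>1 not_integrable_integral_eq unfolding set_integrable_def set_lebesgue_integral_def by fastforce
  \<comment> \<open>Bounds the kernel on \<open>{0..T}\<close>, hence the first weight for every
    admissible step, since \<open>h <= T\<close>.\<close>
  define m where "m = \<rho> 0 + L * T"
  have w0: "0 \<le> weight \<rho> h j" if "h \<in> steps T" for h j
    by (rule weight_nonneg[OF steps(1)[OF that] \<rho>0])
  have wm: "weight \<rho> h 0 \<le> m" if h: "h \<in> steps T" for h
  proof (rule weight_0_le[OF steps(1)[OF h] \<rho>i])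
    fix a assume a: "0 \<le> a" "a \<le> h"
    have "\<rho> a \<le> \<rho> 0 + L * a" using lipschitz_onD[OF L, of a 0] a by (simp add: dist_real_def)
    also have "L * a \<le> L * T"
      using a steps(2)[OF h] lipschitz_on_nonneg[OF L] by (intro mult_left_mono) auto
    finally show "\<rho> a \<le> m" by (simp add: m_def)
  qed
  have m0: "0 \<le> m"
    using \<rho>0[of 0] lipschitz_on_nonneg[OF L] T by (simp add: m_def)
  obtain \<gamma> where \<gamma>: "L2_density T \<gamma>"
      and c\<gamma>: "\<And>s t. 0 \<le> s \<Longrightarrow> s \<le> t \<Longrightarrow> t \<le> T \<Longrightarrow> dist (c t) (c s) \<le> (LBINT u:{s..t}. \<gamma> u)"
    using H1_on_imp_dominated[OF H1] by blast
  have cc: "continuous_on {0..T} c" by (rule continuous_on_if_dominated[OF \<gamma> c\<gamma>])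
  obtain M where M: "\<And>t. t \<in> {0..T} \<Longrightarrow> norm (c t) \<le> M"
    using compact_imp_bounded[OF compact_continuous_image[OF cc compact_Icc]]
    unfolding bounded_iff by blast
  \<comment> \<open>All balls with centres \<open>c t\<close>, \<open>t \<in> {0..T}\<close>, lie in
    the ball of radius \<open>B\<close> about 0; so do the iterates up to time \<open>T\<close> and
    the past.\<close>
  define B where "B = M + r"
  have KB: "norm y \<le> B" if "y \<in> K t" "t \<in> {0..T}" for y t
    using norm_triangle_sub[of y "c t"] that M[of t] by (simp add: K_def B_def dist_norm norm_minus_commute)
  have xB: "norm x \<le> B" using KB[of x 0] assms(15) T by simp
  have Xmem: "X h n \<in> K (real n * h)" if h: "h \<in> steps T" for h n
    unfolding X_def
    by (rule scheme_mem[OF steps(1)[OF h] sums_summable[OF weight_tail_sums[OF steps(1)[OF h] w1[OF h]]] w0[OF h]])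
       (use r in \<open>auto simp: K_def\<close>)
  have XB: "norm (X h n) \<le> B" if h: "h \<in> steps T" and n: "real n * h \<le> T" for h n
    using KB[OF Xmem[OF h]] n steps(1)[OF h] by simp
  have nT: "real n * h \<le> T" if h: "h \<in> steps T" and n: "n \<le> N h" for h n
  proof -
    have "real n * h \<le> real (N h) * h" using n steps(1)[OF h] by (intro mult_right_mono) auto
    then show ?thesis by (simp add: steps(3)[OF h])
  qed
  have B0: "0 \<le> B" using xB norm_ge_zero[of x] by linarith
  \<comment> \<open>The constant of \<open>scheme_increment_le\<close>, with \<open>2 * B\<close>
    bounding the distance of the iterates from the past and \<open>m\<close> bounding the first
    weight.\<close>
  define A where "A = 4 * (2 * B) * m"
  define G where "G s = A * indicator {0..T} s + 2 * \<gamma> s" for s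
  have A0: "0 \<le> A" using B0 m0 by (simp add: A_def)
  have G: "L2_density T G" unfolding G_def[abs_def] by (rule L2_density_affine[OF \<gamma> A0]) simp
  have XxB: "norm (X h i - x) \<le> 2 * B" if "h \<in> steps T" "real i * h \<le> T" for h i
    using norm_triangle_ineq4[of "X h i" x] XB[OF that] xB by simp
  have incr: "dist (X h (n + 1)) (X h n) \<le> (LBINT u:{real n * h..real (n + 1) * h}. G u)"
    if h: "h \<in> steps T" and n: "n < N h" for h n
  proof -
    have n1: "0 \<le> real n * h" "real n * h \<le> real (n + 1) * h" "real (n + 1) * h \<le> T"
      using steps(1)[OF h] nT[OF h, of "n + 1"] n by auto
    have "dist (X h (n + 1)) (X h n) \<le> 4 * (2 * B) * weight \<rho> h 0 * h + 2 * dist (c (real (n + 1) * h)) (c (real n * h))"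
      unfolding X_def K_def
    proof (rule scheme_increment_le[OF steps(1)[OF h] r w1[OF h] w0[OF h] dec[OF h]])
      fix i assume "i \<le> n + 1"
      then show "norm (scheme \<rho> (\<lambda>t. cball (c t) r) x h i - x) \<le> 2 * B"
        using XxB[OF h nT[OF h, of i]] n by (simp add: X_def K_def)
    qed
    also have "\<dots> \<le> A * h + 2 * (LBINT u:{real n * h..real (n + 1) * h}. \<gamma> u)"
      unfolding A_def using c\<gamma>[OF n1] wm[OF h] B0 steps(1)[OF h]
      by (intro add_mono mult_right_mono mult_left_mono) auto
    also have "\<dots> = (LBINT u:{real n * h..real (n + 1) * h}. G u)"
    proof -
      have ci: "set_integrable lborel {real n * h..real (n + 1) * h} (\<lambda>u. A)"
        by (intro borel_integrable_atLeastAtMost') simp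
      \<comment> \<open>The cell lies inside \<open>{0..T}\<close>, so the cut-off in
        \<open>G\<close> is 1 on it and the constant part integrates to exactly
        \<open>A * h\<close>.\<close>
      have "(LBINT u:{real n * h..real (n + 1) * h}. G u) = (LBINT u:{real n * h..real (n + 1) * h}. A + 2 * \<gamma> u)"
        using n1 by (intro set_lebesgue_integral_cong) (auto simp: G_def)
      also have "\<dots> = (LBINT u:{real n * h..real (n + 1) * h}. A) + (LBINT u:{real n * h..real (n + 1) * h}. 2 * \<gamma> u)"
        by (intro set_integral_add(2) ci set_integrable_mult_right L2_density_set_integrable[OF \<gamma>])
      also have "(LBINT u:{real n * h..real (n + 1) * h}. A) = A * h"
        unfolding set_borel_integral_eq_integral(2)[OF ci] using n1 by (simp add: algebra_simps)
      finally show ?thesis by simp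
    qed
    finally show ?thesis .
  qed
  show ?thesis
  proof (intro conjI allI impI)
    define E where "E = (LBINT u:{0..T}. (G u)\<^sup>2)"
    have E0: "0 \<le> E" unfolding E_def set_lebesgue_integral_def by (intro Bochner_Integration.integral_nonneg) simp
    show "\<exists>C>0. \<forall>h\<in>steps T. (SUP n\<in>{0..N h}. norm (X h n)) \<le> C \<and>
        (1 / h) * (\<Sum>n<N h. (norm (X h (n + 1) - X h n))\<^sup>2) \<le> C"
    proof (intro exI[of _ "B + E + 1"] conjI ballI)
      show "0 < B + E + 1" using B0 E0 by simp
      fix h assume h: "h \<in> steps T"
      have "(SUP n\<in>{0..N h}. norm (X h n)) \<le> B"
        by (rule cSUP_least) (use XB[OF h nT[OF h]] in auto)
      then show "(SUP n\<in>{0..N h}. norm (X h n)) \<le> B + E + 1" using E0 by simp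
      have "(1 / h) * (\<Sum>n<N h. (norm (X h (n + 1) - X h n))\<^sup>2) \<le> (LBINT u:{0..real (N h) * h}. (G u)\<^sup>2)"
        by (rule energy_le[OF steps(1)[OF h] G incr[OF h]])
      then show "(1 / h) * (\<Sum>n<N h. (norm (X h (n + 1) - X h n))\<^sup>2) \<le> B + E + 1"
        using B0 by (simp add: steps(3)[OF h] E_def)
    qed
  next
    fix hs :: "nat \<Rightarrow> real"
    assume hs: "(\<forall>k. hs k \<in> steps T) \<and> hs \<longlonglongrightarrow> 0"
    then have st: "hs k \<in> steps T" for k by blast
    obtain \<sigma> y where \<sigma>: "strict_mono \<sigma>" and y: "continuous_on {0..T} y" "H1_on T y"
        and lim: "uniform_limit {0..T} (\<lambda>k. interpolant (hs (\<sigma> k)) (X (hs (\<sigma> k)))) y sequentially"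
    proof (rule interpolants_compact[OF G, of hs "\<lambda>k. N (hs k)" "\<lambda>k. X (hs k)" B])
      show "norm (X (hs k) 0) \<le> B" for k using XB[OF st, of 0 k] T by simp
    qed (use hs steps incr st in auto)
    define Y where "Y t = (if t < 0 then x else y t)" for t
    have Yy: "Y t = y t" if "0 \<le> t" for t using that by (simp add: Y_def)
    have hs\<sigma>: "(\<lambda>k. hs (\<sigma> k)) \<longlonglongrightarrow> 0"
      using LIMSEQ_subseq_LIMSEQ[OF _ \<sigma>] hs by (auto simp: o_def)
    show "\<exists>\<sigma> :: nat \<Rightarrow> nat. \<exists>Y :: real \<Rightarrow> real ^ 'm. strict_mono \<sigma>
               \<and> H1_on T Y \<and> (\<forall>t<0. Y t = x)
               \<and> uniform_limit {0..T} (\<lambda>k. interpolant (hs (\<sigma> k)) (X (hs (\<sigma> k)))) Y sequentially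
               \<and> (AE t in lborel. t \<in> {0<..<T} \<longrightarrow>
                    Y t = closest_point (K t) (LBINT s:{0..}. \<rho> s *\<^sub>R Y (t - s)))"
    proof (intro exI conjI allI impI)
      show "strict_mono \<sigma>" by (rule \<sigma>)
      show "H1_on T Y"
        using y(2) T unfolding H1_on_def by (simp add: Yy)
      show "Y t = x" if "t < 0" for t using that by (simp add: Y_def)
      have Yc: "continuous_on {0..T} Y"
        using y(1) by (rule continuous_on_eq) (simp add: Yy)
      show ul: "uniform_limit {0..T} (\<lambda>k. interpolant (hs (\<sigma> k)) (X (hs (\<sigma> k)))) Y sequentially"
        using lim by (rule uniform_limit_cong'[THEN iffD1, rotated -1]) (auto simp: Yy)
      have "Y t = closest_point (K t) (LBINT s:{0..}. \<rho> s *\<^sub>R Y (t - s))" if t: "t \<in> {0<..<T}" for t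
      proof -
        have "(LBINT s:{0..}. \<rho> s *\<^sub>R Y (t - s)) = x + (LBINT a:{0..t}. \<rho> a *\<^sub>R (Y (t - a) - x))"
          by (rule memory_integral_eq[OF \<rho>c \<rho>i \<rho>1 continuous_on_subset[OF Yc]]) (use t in \<open>auto simp: Y_def\<close>)
        moreover have "Y t = closest_point (cball (c t) r) (x + (LBINT a:{0..t}. \<rho> a *\<^sub>R (Y (t - a) - x)))"
          using t XxB[OF st] ul unfolding X_def K_def
          by (intro scheme_limit_equation[OF \<rho>c \<rho>i \<rho>0 r steps(1)[OF st] hs\<sigma> w1[OF st] wm[OF st] cc _ Yc, where B = "2 * B"]) auto
        ultimately show ?thesis by (simp add: K_def)
      qed
      then show "AE t in lborel. t \<in> {0<..<T} \<longrightarrow> Y t = closest_point (K t) (LBINT s:{0..}. \<rho> s *\<^sub>R Y (t - s))"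
        by simp
    qed
  qed
qed

end
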